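(* Let $\mathcal{X}$ be a finite set, $\mathcal{H}$ a finite-dimensional Hilbert space, $W:\mathcal{X}\to\mathcal{S}(\mathcal{H})$ a classical-quantum channel, and let $p\in\mathcal{P}(\mathcal{X})$ satisfy $I(X;B)_{W\times p}=\inf_{q:\,W(q)=W(p)}I(X;B)_{W\times q}$. For each $n$ let $\mathcal{C}_n=(x^n(1),\dots,x^n(M_n))$ be a codebook of $M_n$ codewords in $\mathcal{X}^n$, and suppose $R_1:=\liminf_{n\to\infty}\frac1n\log M_n<I(X;B)_{W\times p}$. Then \[ \limsup_{n\to\infty}\tfrac12\big\|W^{\otimes n}_{\mathcal{C}_n}-W(p)^{\otimes n}\big\|_1=1 . \]
   Context: $\mathcal{S}(\mathcal{H})$ is the set of density matrices on $\mathcal{H}$, $\mathcal{P}(\mathcal{X})$ the set of probability distributions on $\mathcal{X}$. For $q\in\mathcal{P}(\mathcal{X})$, $W(q)=\sum_xq(x)W_x$ and $I(X;B)_{W\times q}=\sum_xq(x)D(W_x\|W(q))$ with $D(\rho\|\sigma)=\mathrm{Tr}\,\rho(\log\rho-\log\sigma)$; logarithms base 2; the infimum is over all $q\in\mathcal{P}(\mathcal{X})$ with $W(q)=W(p)$. For $x^n\in\mathcal{X}^n$, $W^{\otimes n}_{x^n}=W_{x_1}\otimes\cdots\otimes W_{x_n}$, and $W^{\otimes n}_{\mathcal{C}_n}:=\frac1{M_n}\sum_{m=1}^{M_n}W^{\otimes n}_{x^n(m)}$. *)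

theory Defs
  imports "Jordan_Normal_Form.Schur_Decomposition" "HOL-Library.Extended_Real" "HOL-Library.Liminf_Limsup"
begin

definition mtrace :: "complex mat \<Rightarrow> complex" where
  "mtrace A = (\<Sum>i<dim_row A. A $$ (i,i))"

definition hermitian_mat :: "nat \<Rightarrow> complex mat \<Rightarrow> bool" where
  "hermitian_mat d A \<longleftrightarrow> A \<in> carrier_mat d d \<and> mat_adjoint A = A"

definition unitary_mat :: "nat \<Rightarrow> complex mat \<Rightarrow> bool" where
  "unitary_mat d U \<longleftrightarrow> U \<in> carrier_mat d d \<and> mat_adjoint U * U = 1\<^sub>m d \<and> U * mat_adjoint U = 1\<^sub>m d"

definition density_mat :: "nat \<Rightarrow> complex mat \<Rightarrow> bool" where
  "density_mat d \<rho> \<longleftrightarrow> hermitian_mat d \<rho>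
     \<and> (\<forall>v \<in> carrier_vec d. 0 \<le> Re (conjugate v \<bullet> (\<rho> *\<^sub>v v)))
     \<and> mtrace \<rho> = 1"

definition real_diag_mat :: "nat \<Rightarrow> (nat \<Rightarrow> real) \<Rightarrow> complex mat" where
  "real_diag_mat d l = mat d d (\<lambda>(i,j). if i = j then complex_of_real (l i) else 0)"

text \<open>Functional calculus for Hermitian matrices via a spectral decomposition
  A = U diag(l) U^*.  (The result does not depend on the chosen decomposition.)\<close>
definition mat_fun :: "nat \<Rightarrow> (real \<Rightarrow> real) \<Rightarrow> complex mat \<Rightarrow> complex mat" where
  "mat_fun d f A = (let (U, l) = (SOME (U, l). unitary_mat d U \<and> A = U * real_diag_mat d l * mat_adjoint U)
                    in U * real_diag_mat d (f \<circ> l) * mat_adjoint U)"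

text \<open>Binary logarithm with the convention log 0 := 0 (i.e. the logarithm on the support).\<close>
definition lg :: "real \<Rightarrow> real" where
  "lg x = (if x > 0 then log 2 x else 0)"

text \<open>Umegaki relative entropy D(rho||sigma) = Tr rho (log rho - log sigma) (logarithms base 2,
  taken on supports; this is the correct value whenever supp rho is contained in supp sigma,
  which is always the case where it is used below).\<close>
definition rel_entropy :: "nat \<Rightarrow> complex mat \<Rightarrow> complex mat \<Rightarrow> real" where
  "rel_entropy d \<rho> \<sigma> = Re (mtrace (\<rho> * (mat_fun d lg \<rho> - mat_fun d lg \<sigma>)))"

definition prob_dist :: "('x::finite \<Rightarrow> real) \<Rightarrow> bool" where
  "prob_dist q \<longleftrightarrow> (\<forall>x. 0 \<le> q x) \<and> (\<Sum>x\<in>UNIV. q x) = 1"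

definition avg_state :: "nat \<Rightarrow> ('x::finite \<Rightarrow> complex mat) \<Rightarrow> ('x \<Rightarrow> real) \<Rightarrow> complex mat" where
  "avg_state d W q = mat d d (\<lambda>ij. \<Sum>x\<in>UNIV. complex_of_real (q x) * W x $$ ij)"

definition mutual_info :: "nat \<Rightarrow> ('x::finite \<Rightarrow> complex mat) \<Rightarrow> ('x \<Rightarrow> real) \<Rightarrow> real" where
  "mutual_info d W q = (\<Sum>x\<in>UNIV. q x * rel_entropy d (W x) (avg_state d W q))"

definition trace_norm :: "nat \<Rightarrow> complex mat \<Rightarrow> real" where
  "trace_norm d A = Re (mtrace (mat_fun d sqrt (mat_adjoint A * A)))"

definition kron :: "complex mat \<Rightarrow> complex mat \<Rightarrow> complex mat" where
  "kron A B = mat (dim_row A * dim_row B) (dim_col A * dim_col B)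
     (\<lambda>(i,j). A $$ (i div dim_row B, j div dim_col B) * B $$ (i mod dim_row B, j mod dim_col B))"

fun tensor_word :: "('x \<Rightarrow> complex mat) \<Rightarrow> nat \<Rightarrow> (nat \<Rightarrow> 'x) \<Rightarrow> complex mat" where
  "tensor_word W 0 c = 1\<^sub>m 1"
| "tensor_word W (Suc n) c = kron (tensor_word W n c) (W (c n))"

definition tensor_power :: "complex mat \<Rightarrow> nat \<Rightarrow> complex mat" where
  "tensor_power A n = tensor_word (\<lambda>_::unit. A) n (\<lambda>_. ())"

definition codebook_state :: "nat \<Rightarrow> ('x \<Rightarrow> complex mat) \<Rightarrow> nat \<Rightarrow> nat \<Rightarrow> (nat \<Rightarrow> nat \<Rightarrow> 'x) \<Rightarrow> complex mat" where
  "codebook_state d W n M cw = mat (d ^ n) (d ^ n)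
     (\<lambda>ij. (\<Sum>m\<in>{1..M}. tensor_word W n (cw m) $$ ij) / complex_of_nat M)"

end

theory Submission
  imports "HOL-Analysis.Convex_Euclidean_Space" "HOL-Real_Asymp.Real_Asymp"
    "Jordan_Normal_Form.Spectral_Radius" Defs
begin

text \<open>Write \<open>\<sigma> = W(p)\<close> and let \<open>H\<close> be the von Neumann entropy, so that
  \<open>I(X;B) = H(W(q)) - \<Sum>\<^sub>x q(x) H(W\<^sub>x)\<close>.  With \<open>W(q) = \<sigma>\<close> fixed this is affine in \<open>q\<close>, so by linear
  programming duality the optimality of \<open>p\<close> yields, for every \<open>\<delta> > 0\<close>, a Hermitian matrix \<open>A\<close> with
  \<open>H(W\<^sub>x) \<le> H(\<sigma>) - I(p) + \<delta> + Tr A (W\<^sub>x - \<sigma>)\<close> for all \<open>x\<close>.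

  Consequently each codeword \<open>x\<^sup>n\<close> is of one of two kinds.  Either \<open>\<Sum>\<^sub>i Tr A (W\<^bsub>x\<^sub>i\<^esub> - \<sigma>) > n\<delta>\<close>, and then
  the spectral projection \<open>S\<close> of \<open>\<Sum>\<^sub>i A\<^sub>i\<close> onto values above \<open>n (Tr A\<sigma> + \<delta>/2)\<close> distinguishes its output
  from \<open>\<sigma>\<^bsup>\<otimes>n\<^esup>\<close>; or its output is concentrated on at most \<open>2\<^bsup>n(H(\<sigma>) - I(p) + 3\<delta>)\<^esup>\<close> eigenvectors.
  The test is the projection onto the span of the range of \<open>S\<close> and of all these eigenvectors.
  It accepts every output state up to \<open>O(1/n)\<close>.  Gram--Schmidt enlarges the range of \<open>S\<close> by at most
  \<open>M\<^sub>n 2\<^bsup>n(H(\<sigma>) - I(p) + 3\<delta>)\<^esup>\<close> orthonormal vectors, and up to a total error \<open>O(1/n)\<close> each of them has weight at most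
  \<open>2\<^bsup>-n(H(\<sigma>) - \<delta>)\<^esup>\<close> in \<open>\<sigma>\<^bsup>\<otimes>n\<^esup>\<close>, so \<open>\<sigma>\<^bsup>\<otimes>n\<^esup>\<close> passes the test with vanishing probability
  whenever \<open>M\<^sub>n \<le> 2\<^bsup>nR\<^esup>\<close> with \<open>R < I(p) - 4\<delta>\<close>.\<close>

section \<open>Orthonormal families\<close>

text \<open>Vectors are functions on the naturals of which only the values below \<open>N\<close>
  count. This keeps families over arbitrary index sets free of dimension side conditions.\<close>

definition cip :: "nat \<Rightarrow> (nat \<Rightarrow> complex) \<Rightarrow> (nat \<Rightarrow> complex) \<Rightarrow> complex" where
  "cip N u v = (\<Sum>i<N. cnj (u i) * v i)"

definition sqnorm :: "nat \<Rightarrow> (nat \<Rightarrow> complex) \<Rightarrow> real" where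
  "sqnorm N v = (\<Sum>i<N. (cmod (v i))\<^sup>2)"

text \<open>The index set is an arbitrary set of naturals, so that a family can be enlarged at fresh
  indices while the old members keep theirs.\<close>

definition orthonormal_family :: "nat \<Rightarrow> nat set \<Rightarrow> (nat \<Rightarrow> nat \<Rightarrow> complex) \<Rightarrow> bool" where
  "orthonormal_family N I e \<longleftrightarrow> (\<forall>a\<in>I. \<forall>b\<in>I. cip N (e a) (e b) = (if a = b then 1 else 0))"

lemma cip_self: "cip N v v = of_real (sqnorm N v)"
  unfolding cip_def sqnorm_def of_real_sum
  by (intro sum.cong refl) (metis complex_norm_square mult.commute)

lemma sqnorm_nonneg: "0 \<le> sqnorm N v"
  unfolding sqnorm_def by (intro sum_nonneg) auto

lemma cnj_cip: "cnj (cip N u v) = cip N v u"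
  unfolding cip_def by (simp add: mult.commute)

lemma cip_sum_right: "cip N u (\<lambda>i. \<Sum>a\<in>I. c a * f a i) = (\<Sum>a\<in>I. c a * cip N u (f a))"
  unfolding cip_def sum_distrib_left by (subst sum.swap) (simp add: mult_ac)

lemma cip_sum_left: "cip N (\<lambda>i. \<Sum>a\<in>I. c a * f a i) v = (\<Sum>a\<in>I. cnj (c a) * cip N (f a) v)"
  unfolding cip_def cnj_sum sum_distrib_left sum_distrib_right by (subst sum.swap) (simp add: mult_ac)

lemma cip_diff_right: "cip N u (\<lambda>i. v i - w i) = cip N u v - cip N u w"
  unfolding cip_def by (simp add: right_diff_distrib sum_subtractf)

lemma cip_diff_left: "cip N (\<lambda>i. v i - w i) u = cip N v u - cip N w u"
  unfolding cip_def by (simp add: left_diff_distrib sum_subtractf)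

lemma cip_scale_right: "cip N u (\<lambda>i. c * v i) = c * cip N u v"
  unfolding cip_def by (simp add: sum_distrib_left mult_ac)

lemma cip_scale_left: "cip N (\<lambda>i. c * v i) u = cnj c * cip N v u"
  unfolding cip_def by (simp add: sum_distrib_left mult_ac)

lemma cip_cong:
  assumes "\<And>i. i < N \<Longrightarrow> u i = u' i" "\<And>i. i < N \<Longrightarrow> v i = v' i"
  shows "cip N u v = cip N u' v'"
  unfolding cip_def by (intro sum.cong) (auto simp: assms)

lemma cip_mult_cnj: "cip N u v * cip N v u = of_real ((cmod (cip N u v))\<^sup>2)"
  by (metis complex_norm_square cnj_cip)

lemma cmod_cip_commute: "cmod (cip N u v) = cmod (cip N v u)"
  by (metis cnj_cip complex_mod_cnj)

lemma residual_orthogonal: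
  assumes "finite I" "orthonormal_family N I e" "b \<in> I"
  shows "cip N (e b) (\<lambda>i. v i - (\<Sum>a\<in>I. cip N (e a) v * e a i)) = 0"
proof -
  have "(\<Sum>a\<in>I. cip N (e a) v * cip N (e b) (e a)) = (\<Sum>a\<in>I. if a = b then cip N (e a) v else 0)"
    using assms unfolding orthonormal_family_def by (intro sum.cong) auto
  then show ?thesis
    using assms by (simp add: cip_diff_right cip_sum_right)
qed

text \<open>Pythagoras: the residual is orthogonal to every \<open>e a\<close>, so its inner product
  with itself equals that of \<open>v\<close> with it.\<close>

lemma sqnorm_residual:
  assumes "finite I" "orthonormal_family N I e"
  shows "sqnorm N (\<lambda>i. v i - (\<Sum>a\<in>I. cip N (e a) v * e a i))
       = sqnorm N v - (\<Sum>a\<in>I. (cmod (cip N (e a) v))\<^sup>2)"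
proof -
  define w where "w = (\<lambda>i. v i - (\<Sum>a\<in>I. cip N (e a) v * e a i))"
  have "cip N w w = cip N v w - (\<Sum>a\<in>I. cnj (cip N (e a) v) * cip N (e a) w)"
    unfolding w_def cip_diff_left cip_sum_left by simp
  also have "(\<Sum>a\<in>I. cnj (cip N (e a) v) * cip N (e a) w) = 0"
    using residual_orthogonal[OF assms] unfolding w_def by simp
  also have "cip N v w = cip N v v - (\<Sum>a\<in>I. cip N (e a) v * cip N v (e a))"
    unfolding w_def cip_diff_right cip_sum_right by simp
  finally have "complex_of_real (sqnorm N w) = of_real (sqnorm N v - (\<Sum>a\<in>I. (cmod (cip N (e a) v))\<^sup>2))"
    by (simp add: cip_self cip_mult_cnj)
  then show ?thesis unfolding w_def of_real_eq_iff .
qed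

lemma bessel:
  assumes "finite I" "orthonormal_family N I e"
  shows "(\<Sum>a\<in>I. (cmod (cip N (e a) v))\<^sup>2) \<le> sqnorm N v"
  using sqnorm_residual[OF assms, of v] sqnorm_nonneg[of N "\<lambda>i. v i - (\<Sum>a\<in>I. cip N (e a) v * e a i)"]
  by linarith

text \<open>Equality in Bessel's inequality leaves a residual of norm zero. This equality serves
  throughout as the way to say that \<open>v\<close> lies in the span of the family.\<close>

lemma expansion_if_bessel_eq:
  assumes "finite I" "orthonormal_family N I e"
    and "(\<Sum>a\<in>I. (cmod (cip N (e a) v))\<^sup>2) = sqnorm N v" "i < N"
  shows "v i = (\<Sum>a\<in>I. cip N (e a) v * e a i)"
proof -
  have "sqnorm N (\<lambda>i. v i - (\<Sum>a\<in>I. cip N (e a) v * e a i)) = 0"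
    using sqnorm_residual[OF assms(1,2), of v] assms(3) by simp
  then have "(cmod (v i - (\<Sum>a\<in>I. cip N (e a) v * e a i)))\<^sup>2 = 0"
    unfolding sqnorm_def using assms(4) by (subst (asm) sum_nonneg_eq_0_iff) auto
  then show ?thesis by simp
qed

lemma orthonormal_family_insert:
  assumes "orthonormal_family N I e" "c \<notin> I" "sqnorm N u = 1" "\<And>a. a \<in> I \<Longrightarrow> cip N (e a) u = 0"
  shows "orthonormal_family N (insert c I) (e(c := u))"
proof -
  have "cip N u (e a) = 0" if "a \<in> I" for a
    using assms(4)[OF that] by (metis cnj_cip complex_cnj_zero)
  then show ?thesis
    using assms cip_self[of N u] unfolding orthonormal_family_def by auto
qed

lemma sqnorm_scale: "sqnorm N (\<lambda>i. c * v i) = (cmod c)\<^sup>2 * sqnorm N v"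
  unfolding sqnorm_def by (simp add: norm_mult power_mult_distrib sum_distrib_left)

text \<open>Gram-Schmidt with a count: each vector of \<open>L\<close> costs at most one new index.
  The bound on \<open>card J\<close> later limits how much the test is enlarged.\<close>

lemma extend_orthonormal_family:
  assumes "finite L" "finite I" "orthonormal_family N I e"
  shows "\<exists>J f. finite J \<and> I \<inter> J = {} \<and> card J \<le> card L \<and> orthonormal_family N (I \<union> J) f
    \<and> (\<forall>a\<in>I. f a = e a) \<and> (\<forall>v\<in>L. (\<Sum>a\<in>I \<union> J. (cmod (cip N (f a) v))\<^sup>2) = sqnorm N v)"
  using assms(1)
proof (induction L rule: finite_induct)
  case empty
  show ?case using assms by (intro exI[of _ "{}"] exI[of _ e]) auto
next
  case (insert v L)
  then obtain J f where J: "finite J" "I \<inter> J = {}" "card J \<le> card L" "orthonormal_family N (I \<union> J) f"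
    "\<forall>a\<in>I. f a = e a" "\<forall>v\<in>L. (\<Sum>a\<in>I \<union> J. (cmod (cip N (f a) v))\<^sup>2) = sqnorm N v"
    by blast
  have fin: "finite (I \<union> J)" using J assms by auto
  define w where "w = (\<lambda>i. v i - (\<Sum>a\<in>I \<union> J. cip N (f a) v * f a i))"
  have w: "sqnorm N w = sqnorm N v - (\<Sum>a\<in>I \<union> J. (cmod (cip N (f a) v))\<^sup>2)"
    unfolding w_def by (rule sqnorm_residual[OF fin J(4)])
  have worth: "cip N (f a) w = 0" if "a \<in> I \<union> J" for a
    unfolding w_def by (rule residual_orthogonal[OF fin J(4) that])
  show ?case
  proof (cases "sqnorm N w = 0")
    case True
    then show ?thesis
      using J w insert.hyps by (intro exI[of _ J] exI[of _ f]) (auto simp: card_insert_if)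
  next
    case False
    then have pos: "sqnorm N w > 0" using sqnorm_nonneg[of N w] by linarith
    define r where "r = complex_of_real (1 / sqrt (sqnorm N w))"
    have r2: "(cmod r)\<^sup>2 = 1 / sqnorm N w"
      using pos unfolding r_def norm_of_real by (simp add: power_divide)
    define u where "u = (\<lambda>i. r * w i)"
    have u1: "sqnorm N u = 1" unfolding u_def sqnorm_scale r2 using pos by simp
    have uorth: "cip N (f a) u = 0" if "a \<in> I \<union> J" for a
      unfolding u_def cip_scale_right using worth[OF that] by simp
    obtain c where c: "c \<notin> I \<union> J" using ex_new_if_finite[OF infinite_UNIV_nat fin] by blast
    have on: "orthonormal_family N (insert c (I \<union> J)) (f(c := u))"
      by (rule orthonormal_family_insert[OF J(4) c u1 uorth])
    have sum_ins: "(\<Sum>a\<in>I \<union> insert c J. (cmod (cip N ((f(c := u)) a) x))\<^sup>2)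
        = (cmod (cip N u x))\<^sup>2 + (\<Sum>a\<in>I \<union> J. (cmod (cip N (f a) x))\<^sup>2)" for x
    proof -
      have "(\<Sum>a\<in>I \<union> J. (cmod (cip N ((f(c := u)) a) x))\<^sup>2) = (\<Sum>a\<in>I \<union> J. (cmod (cip N (f a) x))\<^sup>2)"
        using c by (intro sum.cong) auto
      then show ?thesis using c fin by simp
    qed
    have uv: "cip N u v = cnj r * of_real (sqnorm N w)"
    proof -
      have "cip N w w = cip N w v - (\<Sum>a\<in>I \<union> J. cip N (f a) v * cip N w (f a))"
        by (subst (2) w_def) (simp only: cip_diff_right cip_sum_right)
      also have "(\<Sum>a\<in>I \<union> J. cip N (f a) v * cip N w (f a)) = 0"
      proof (intro sum.neutral ballI)
        fix a assume "a \<in> I \<union> J"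
        then have "cip N w (f a) = 0" using worth cnj_cip[of N "f a" w] by simp
        then show "cip N (f a) v * cip N w (f a) = 0" by simp
      qed
      finally show ?thesis unfolding u_def cip_scale_left by (simp add: cip_self)
    qed
    have "(cmod (cip N u v))\<^sup>2 = sqnorm N w"
      unfolding uv norm_mult power_mult_distrib complex_mod_cnj r2 using pos by (simp add: power2_eq_square)
    \<comment> \<open>For the earlier vectors equality holds already, so Bessel's inequality for the
      enlarged family forces their component along \<open>u\<close> to vanish.\<close>
    moreover have "(cmod (cip N u x))\<^sup>2 = 0" if "x \<in> L" for x
    proof -
      have "(cmod (cip N u x))\<^sup>2 + (\<Sum>a\<in>I \<union> J. (cmod (cip N (f a) x))\<^sup>2) \<le> sqnorm N x"
        using bessel[of "insert c (I \<union> J)" N "f(c := u)" x] fin on unfolding sum_ins[symmetric] by simp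
      then have "(cmod (cip N u x))\<^sup>2 \<le> 0" using J(6) that by simp
      then show ?thesis by simp
    qed
    ultimately have "\<forall>x\<in>insert v L. (\<Sum>a\<in>I \<union> insert c J. (cmod (cip N ((f(c := u)) a) x))\<^sup>2) = sqnorm N x"
      unfolding sum_ins using w J(6) by auto
    moreover have "card (insert c J) \<le> card (insert v L)"
      using J(1,3) c insert.hyps by simp
    moreover have "\<forall>a\<in>I. (f(c := u)) a = e a" using J(5) c by auto
    moreover have "orthonormal_family N (I \<union> insert c J) (f(c := u))"
      using on by (simp only: Un_insert_right)
    moreover have "finite (insert c J)" "I \<inter> insert c J = {}" using J(1,2) c by auto
    ultimately show ?thesis by blast
  qed
qed

section \<open>Dimension counting, Parseval's identity and completion to a basis\<close>

definition std_vec :: "nat \<Rightarrow> nat \<Rightarrow> complex" where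
  "std_vec k = (\<lambda>i. if i = k then 1 else 0)"

lemma cip_std_vec: "k < N \<Longrightarrow> cip N u (std_vec k) = cnj (u k)"
  using sum.delta[of "{..<N}" k "\<lambda>i. cnj (u i)"] unfolding cip_def std_vec_def
  by (simp add: if_distrib[of "(*) _"] cong: if_cong)

lemma sqnorm_std_vec: "k < N \<Longrightarrow> sqnorm N (std_vec k) = 1"
  unfolding sqnorm_def std_vec_def by (simp add: if_distrib[of cmod] if_distrib[of "\<lambda>x. x\<^sup>2"] cong: if_cong)

lemma orthonormal_family_sqnorm:
  assumes "orthonormal_family N I e" "a \<in> I"
  shows "sqnorm N (e a) = 1"
proof -
  have "complex_of_real (sqnorm N (e a)) = of_real 1"
    using assms unfolding orthonormal_family_def cip_self[symmetric] by simp
  then show ?thesis unfolding of_real_eq_iff .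
qed

text \<open>Double counting of the squared moduli of all entries: by vectors the total is
  \<open>card I\<close>, by coordinates it is \<open>N\<close>.\<close>

lemma complete_of_std_vec:
  assumes "finite I" "orthonormal_family N I e"
    and "\<And>k. k < N \<Longrightarrow> (\<Sum>a\<in>I. (cmod (cip N (e a) (std_vec k)))\<^sup>2) = 1"
  shows "card I = N"
proof -
  have "real (card I) = (\<Sum>a\<in>I. sqnorm N (e a))"
    using orthonormal_family_sqnorm[OF assms(2)] by simp
  also have "\<dots> = (\<Sum>k<N. \<Sum>a\<in>I. (cmod (e a k))\<^sup>2)"
    unfolding sqnorm_def by (rule sum.swap)
  also have "\<dots> = (\<Sum>k<N. 1)"
    using assms(3) by (intro sum.cong refl) (simp add: cip_std_vec)
  finally show ?thesis by simp
qed

lemma orthonormal_family_card_le: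
  assumes "finite I" "orthonormal_family N I e"
  shows "card I \<le> N"
proof -
  have "real (card I) = (\<Sum>a\<in>I. sqnorm N (e a))"
    using orthonormal_family_sqnorm[OF assms(2)] by simp
  also have "\<dots> = (\<Sum>k<N. \<Sum>a\<in>I. (cmod (e a k))\<^sup>2)"
    unfolding sqnorm_def by (rule sum.swap)
  also have "\<dots> \<le> (\<Sum>k<N. 1)"
  proof (intro sum_mono)
    fix k assume "k \<in> {..<N}"
    then show "(\<Sum>a\<in>I. (cmod (e a k))\<^sup>2) \<le> 1"
      using bessel[OF assms, of "std_vec k"] by (simp add: cip_std_vec sqnorm_std_vec)
  qed
  finally show ?thesis by simp
qed

text \<open>After an extension that captures \<open>v\<close>, the family still has at most
  \<open>N\<close> members. So nothing was added, and \<open>v\<close> was captured from the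
  start.\<close>

lemma parseval:
  assumes "orthonormal_family N {..<N} e"
  shows "(\<Sum>a<N. (cmod (cip N (e a) v))\<^sup>2) = sqnorm N v"
proof -
  obtain J f where J: "finite J" "{..<N} \<inter> J = {}" "orthonormal_family N ({..<N} \<union> J) f"
    "\<forall>a\<in>{..<N}. f a = e a" "(\<Sum>a\<in>{..<N} \<union> J. (cmod (cip N (f a) v))\<^sup>2) = sqnorm N v"
    using extend_orthonormal_family[of "{v}" "{..<N}" N e] assms by auto
  have "card ({..<N} \<union> J) = N + card J"
    using J by (subst card_Un_disjoint) auto
  then have "J = {}"
    using orthonormal_family_card_le[OF _ J(3)] J(1) by simp
  then show ?thesis using J(4,5) by simp
qed

text \<open>Extending the family of \<open>u\<close> alone until it captures all standard vectors
  gives \<open>Suc N\<close> members; what remains is a renumbering that keeps \<open>u\<close> at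
  index 0.\<close>

lemma extend_to_orthonormal_basis:
  assumes "sqnorm (Suc N) u = 1"
  shows "\<exists>e. orthonormal_family (Suc N) {..<Suc N} e \<and> e 0 = u"
proof -
  have on0: "orthonormal_family (Suc N) {0} (\<lambda>_. u)"
    using assms by (simp add: orthonormal_family_def cip_self)
  obtain J f where J: "finite J" "{0} \<inter> J = {}" "orthonormal_family (Suc N) ({0} \<union> J) f" "f 0 = u"
    "\<forall>v\<in>std_vec ` {..<Suc N}. (\<Sum>a\<in>{0} \<union> J. (cmod (cip (Suc N) (f a) v))\<^sup>2) = sqnorm (Suc N) v"
    using extend_orthonormal_family[OF _ _ on0, of "std_vec ` {..<Suc N}"] by auto
  have "card ({0} \<union> J) = Suc N"
    using J sqnorm_std_vec by (intro complete_of_std_vec[OF _ J(3)]) auto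
  then have "card J = N" using J(1,2) by simp
  then obtain g where g: "bij_betw g {1..N} J"
    using J(1) by (metis One_nat_def card_atLeastAtMost diff_Suc_1 finite_atLeastAtMost finite_same_card_bij)
  define h where "h = (\<lambda>k. if k = 0 then 0 else g k)"
  have mem: "h k \<in> {0} \<union> J" if "k < Suc N" for k
    using g that unfolding h_def bij_betw_def by auto
  have "h k \<noteq> h l" if "k < l" "l < Suc N" for k l
  proof (cases "k = 0")
    case True
    have "h l \<in> J" "0 \<notin> J" using bij_betw_apply[OF g, of l] that J(2) unfolding h_def by auto
    then show ?thesis using True unfolding h_def by (metis (full_types))
  next
    case False
    then show ?thesis
      using that inj_onD[OF bij_betw_imp_inj_on[OF g], of k l] unfolding h_def by auto
  qed
  then have inj: "h k = h l \<longleftrightarrow> k = l" if "k < Suc N" "l < Suc N" for k l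
    using that by (metis linorder_neqE_nat)
  have "orthonormal_family (Suc N) {..<Suc N} (\<lambda>k. f (h k))"
    unfolding orthonormal_family_def
  proof (intro ballI)
    fix k l assume "k \<in> {..<Suc N}" "l \<in> {..<Suc N}"
    then have kl: "h k \<in> {0} \<union> J" "h l \<in> {0} \<union> J" "h k = h l \<longleftrightarrow> k = l"
      using mem[of k] mem[of l] inj[of k l] by auto
    have "cip (Suc N) (f (h k)) (f (h l)) = (if h k = h l then 1 else 0)"
      using J(3) kl(1,2) unfolding orthonormal_family_def by blast
    then show "cip (Suc N) (f (h k)) (f (h l)) = (if k = l then 1 else 0)" unfolding kl(3) .
  qed
  then show ?thesis using J(4) by (intro exI[of _ "\<lambda>k. f (h k)"]) (auto simp: h_def)
qed

lemma eigenvector_exists: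
  fixes a :: "nat \<Rightarrow> nat \<Rightarrow> complex"
  assumes "0 < N"
  shows "\<exists>u l. sqnorm N u = 1 \<and> (\<forall>i<N. (\<Sum>j<N. a i j * u j) = l * u i)"
proof -
  define A where "A = mat N N (\<lambda>(i,j). a i j)"
  have A: "A \<in> carrier_mat N N" unfolding A_def by simp
  obtain l where "l \<in> spectrum A" using spectrum_non_empty[OF A] assms by auto
  then obtain v where "eigenvector A v l" unfolding spectrum_def eigenvalue_def by auto
  then have v: "v \<in> carrier_vec N" "v \<noteq> 0\<^sub>v N" "A *\<^sub>v v = l \<cdot>\<^sub>v v"
    unfolding eigenvector_def using A by auto
  obtain k where k: "k < N" "v $ k \<noteq> 0"
    using v(1,2) by (metis carrier_vecD eq_vecI index_zero_vec)
  define x where "x = (\<lambda>i. v $ i)"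
  have pos: "sqnorm N x > 0"
    unfolding sqnorm_def x_def using k by (intro sum_pos2[of _ k]) auto
  define r where "r = complex_of_real (1 / sqrt (sqnorm N x))"
  have r2: "(cmod r)\<^sup>2 = 1 / sqnorm N x"
    using pos unfolding r_def norm_of_real by (simp add: power_divide)
  have "(\<Sum>j<N. a i j * x j) = l * x i" if "i < N" for i
  proof -
    have "(A *\<^sub>v v) $ i = (\<Sum>j<N. a i j * x j)"
      using that v(1) A unfolding A_def x_def by (simp add: scalar_prod_def lessThan_atLeast0)
    then show ?thesis using that v unfolding x_def by simp
  qed
  then have "(\<Sum>j<N. a i j * (r * x j)) = l * (r * x i)" if "i < N" for i
    using that sum_distrib_left[of r "\<lambda>j. a i j * x j" "{..<N}"] by (simp add: mult_ac)
  then show ?thesis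
    using pos r2 by (intro exI[of _ "\<lambda>i. r * x i"] exI[of _ l]) (simp add: sqnorm_scale)
qed

section \<open>Spectral decompositions\<close>

text \<open>Induction on the dimension: split off one unit eigenvector \<open>u\<close>, compress
  the operator to the orthogonal complement, diagonalise it there, and carry the eigenvectors
  back.\<close>

lemma spectral_theorem_fun:
  fixes a :: "nat \<Rightarrow> nat \<Rightarrow> complex"
  assumes "\<And>i j. i < N \<Longrightarrow> j < N \<Longrightarrow> a j i = cnj (a i j)"
  shows "\<exists>e (l :: nat \<Rightarrow> real). orthonormal_family N {..<N} e
    \<and> (\<forall>k<N. \<forall>i<N. (\<Sum>j<N. a i j * e k j) = of_real (l k) * e k i)"
  using assms
proof (induction N arbitrary: a)
  case 0
  show ?case by (simp add: orthonormal_family_def)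
next
  case (Suc N)
  let ?n = "Suc N"
  define app where "app = (\<lambda>v i. \<Sum>j<?n. a i j * v j)"
  have sa: "cip ?n x (app y) = cip ?n (app x) y" for x y
  proof -
    have "cip ?n x (app y) = (\<Sum>i<?n. \<Sum>j<?n. cnj (x i) * (a i j * y j))"
      unfolding cip_def app_def sum_distrib_left ..
    also have "\<dots> = (\<Sum>j<?n. \<Sum>i<?n. cnj (x i) * (a i j * y j))"
      by (rule sum.swap)
    also have "\<dots> = (\<Sum>j<?n. \<Sum>i<?n. cnj (a j i * x i) * y j)"
    proof (intro sum.cong refl)
      fix i j assume "j \<in> {..<?n}" "i \<in> {..<?n}"
      then have "a j i = cnj (a i j)" by (intro Suc.prems) auto
      then show "cnj (x i) * (a i j * y j) = cnj (a j i * x i) * y j" by (simp add: mult_ac)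
    qed
    also have "\<dots> = cip ?n (app x) y"
      unfolding cip_def app_def cnj_sum sum_distrib_right ..
    finally show ?thesis .
  qed
  obtain u c where u: "sqnorm ?n u = 1" and uc: "\<And>i. i < ?n \<Longrightarrow> app u i = c * u i"
    using eigenvector_exists[of ?n a] unfolding app_def by blast
  have c1: "cip ?n v (app u) = c * cip ?n v u" for v
    unfolding cip_scale_right[symmetric] by (rule cip_cong) (auto simp: uc)
  have c2: "cip ?n (app u) v = cnj c * cip ?n u v" for v
    unfolding cip_scale_left[symmetric] by (rule cip_cong) (auto simp: uc)
  have "c = cnj c" using c1[of u] c2[of u] sa[of u u] u by (simp add: cip_self)
  then have creal: "of_real (Re c) = c" by (metis Reals_cnj_iff of_real_Re)
  obtain w where w: "orthonormal_family ?n {..<?n} w" and w0: "w 0 = u"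
    using extend_to_orthonormal_basis[OF u] by blast
  have wip: "cip ?n (w i) (w j) = (if i = j then 1 else 0)" if "i < ?n" "j < ?n" for i j
    using w that unfolding orthonormal_family_def by simp
  \<comment> \<open>The matrix of the compression to the complement of \<open>u\<close>, in the
    basis formed by the \<open>w (Suc i)\<close>.\<close>
  define b where "b = (\<lambda>i j. cip ?n (w (Suc i)) (app (w (Suc j))))"
  have "b j i = cnj (b i j)" if "i < N" "j < N" for i j
    unfolding b_def cnj_cip by (rule sa)
  then obtain e' and l' :: "nat \<Rightarrow> real" where e': "orthonormal_family N {..<N} e'"
    and l': "\<And>k i. k < N \<Longrightarrow> i < N \<Longrightarrow> (\<Sum>j<N. b i j * e' k j) = of_real (l' k) * e' k i"
    using Suc.IH[of b] by blast
  define e where "e = (\<lambda>k. case k of 0 \<Rightarrow> u | Suc k \<Rightarrow> (\<lambda>i. \<Sum>j<N. e' k j * w (Suc j) i))"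
  define l where "l = (\<lambda>k. case k of 0 \<Rightarrow> Re c | Suc k \<Rightarrow> l' k)"
  have e0: "e 0 = u" and eS: "e (Suc k) = (\<lambda>i. \<Sum>j<N. e' k j * w (Suc j) i)" for k
    unfolding e_def by auto
  have u_eS: "cip ?n u (e (Suc k)) = 0" for k
    unfolding eS cip_sum_right w0[symmetric] by (intro sum.neutral) (simp add: wip)
  have eS_eS: "cip ?n (e (Suc k)) (e (Suc m)) = cip N (e' k) (e' m)" for k m
  proof -
    have "cip ?n (e (Suc k)) (e (Suc m)) = (\<Sum>i<N. \<Sum>j<N. cnj (e' k i) * (e' m j * cip ?n (w (Suc i)) (w (Suc j))))"
      unfolding eS cip_sum_left cip_sum_right sum_distrib_left ..
    also have "\<dots> = (\<Sum>i<N. \<Sum>j<N. if j = i then cnj (e' k i) * e' m j else 0)"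
      by (intro sum.cong refl) (simp add: wip)
    also have "\<dots> = cip N (e' k) (e' m)"
      unfolding cip_def by (intro sum.cong refl) simp
    finally show ?thesis .
  qed
  have "cip ?n (e k) (e m) = (if k = m then 1 else 0)" if "k < ?n" "m < ?n" for k m
  proof (cases k; cases m)
    fix k' m' assume "k = Suc k'" "m = Suc m'"
    then show ?thesis using e' that eS_eS unfolding orthonormal_family_def by simp
  next
    fix k' assume km: "k = Suc k'" "m = 0"
    have "cip ?n (e (Suc k')) u = cnj (cip ?n u (e (Suc k')))" by (simp add: cnj_cip)
    then show ?thesis using km by (simp add: e0 u_eS)
  qed (use u u_eS in \<open>auto simp: e0 cip_self\<close>)
  then have on: "orthonormal_family ?n {..<?n} e" unfolding orthonormal_family_def by simp
  \<comment> \<open>The complement of \<open>u\<close> is invariant: by symmetry the component of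
    \<open>app (w (Suc j))\<close> along \<open>u\<close> is an inner product of
    \<open>app u\<close>, a multiple of \<open>u\<close>, with \<open>w (Suc j)\<close>. So the
    expansion has no term at \<open>w 0\<close>.\<close>
  have app_w: "app (w (Suc j)) i = (\<Sum>m<N. b m j * w (Suc m) i)" if "j < N" "i < ?n" for i j
  proof -
    have "cip ?n u (app (w (Suc j))) = 0"
      unfolding sa c2 unfolding w0[symmetric] using that by (simp add: wip)
    then show ?thesis
      using expansion_if_bessel_eq[OF _ w parseval[OF w] that(2), of "app (w (Suc j))"]
      by (simp only: sum.lessThan_Suc_shift b_def w0 finite_lessThan) simp
  qed
  have "(\<Sum>j<?n. a i j * e k j) = of_real (l k) * e k i" if k: "k < ?n" and i: "i < ?n" for k i
  proof (cases k)
    case 0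
    then show ?thesis using uc[OF i] creal unfolding app_def by (simp add: e0 l_def)
  next
    case (Suc m)
    have "(\<Sum>j<?n. a i j * e k j) = (\<Sum>j<?n. \<Sum>q<N. a i j * (e' m q * w (Suc q) j))"
      unfolding Suc eS sum_distrib_left ..
    also have "\<dots> = (\<Sum>q<N. \<Sum>j<?n. a i j * (e' m q * w (Suc q) j))"
      by (rule sum.swap)
    also have "\<dots> = (\<Sum>q<N. e' m q * app (w (Suc q)) i)"
      unfolding app_def sum_distrib_left by (simp only: mult.left_commute)
    also have "\<dots> = (\<Sum>q<N. \<Sum>r<N. e' m q * (b r q * w (Suc r) i))"
      unfolding sum_distrib_left[symmetric] using app_w i by simp
    also have "\<dots> = (\<Sum>r<N. \<Sum>q<N. e' m q * (b r q * w (Suc r) i))"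
      by (rule sum.swap)
    also have "\<dots> = (\<Sum>r<N. (\<Sum>q<N. b r q * e' m q) * w (Suc r) i)"
      unfolding sum_distrib_right by (simp only: mult_ac)
    also have "\<dots> = (\<Sum>r<N. of_real (l' m) * (e' m r * w (Suc r) i))"
      using l'[of m] k Suc by (intro sum.cong refl) simp
    also have "\<dots> = of_real (l k) * e k i"
      unfolding Suc eS l_def sum_distrib_left by simp
    finally show ?thesis .
  qed
  then show ?case using on by blast
qed

section \<open>Spectral decompositions of Hermitian matrices\<close>

definition mcol :: "complex mat \<Rightarrow> nat \<Rightarrow> nat \<Rightarrow> complex" where
  "mcol U k = (\<lambda>i. U $$ (i, k))"

text \<open>The body is the condition under which \<open>mat_fun\<close> picks its decomposition, so
  facts about arbitrary decompositions apply to the chosen one.\<close>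

definition spectral_decomp :: "nat \<Rightarrow> complex mat \<Rightarrow> complex mat \<Rightarrow> (nat \<Rightarrow> real) \<Rightarrow> bool" where
  "spectral_decomp N A U l \<longleftrightarrow> unitary_mat N U \<and> A = U * real_diag_mat N l * mat_adjoint U"

lemma mat_adjoint_carrier [simp]: "A \<in> carrier_mat n m \<Longrightarrow> mat_adjoint A \<in> carrier_mat m n"
  unfolding mat_adjoint_def by auto

lemma mat_adjoint_index:
  "A \<in> carrier_mat n m \<Longrightarrow> i < m \<Longrightarrow> j < n \<Longrightarrow> mat_adjoint A $$ (i, j) = cnj (A $$ (j, i))"
  unfolding mat_adjoint_def by (auto simp: mat_of_rows_index)

lemma mat_mult_index:
  "A \<in> carrier_mat n m \<Longrightarrow> B \<in> carrier_mat m p \<Longrightarrow> i < n \<Longrightarrow> j < p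
   \<Longrightarrow> (A * B) $$ (i, j) = (\<Sum>k<m. A $$ (i, k) * B $$ (k, j))"
  by (auto simp: scalar_prod_def lessThan_atLeast0)

lemma real_diag_mat_carrier [simp]: "real_diag_mat N l \<in> carrier_mat N N"
  unfolding real_diag_mat_def by simp

lemma real_diag_mat_index:
  "i < N \<Longrightarrow> j < N \<Longrightarrow> real_diag_mat N l $$ (i, j) = (if i = j then of_real (l i) else 0)"
  unfolding real_diag_mat_def by simp

lemma mult_real_diag_index:
  assumes "A \<in> carrier_mat n N" "i < n" "j < N"
  shows "(A * real_diag_mat N l) $$ (i, j) = A $$ (i, j) * of_real (l j)"
proof -
  have "(A * real_diag_mat N l) $$ (i, j) = (\<Sum>k<N. if k = j then A $$ (i, k) * of_real (l k) else 0)"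
    unfolding mat_mult_index[OF assms(1) real_diag_mat_carrier assms(2,3)]
    by (intro sum.cong refl) (use assms in \<open>auto simp: real_diag_mat_index\<close>)
  then show ?thesis using assms(3) by simp
qed

lemma real_diag_mult_index:
  assumes "A \<in> carrier_mat N n" "i < N" "j < n"
  shows "(real_diag_mat N l * A) $$ (i, j) = of_real (l i) * A $$ (i, j)"
proof -
  have "(real_diag_mat N l * A) $$ (i, j) = (\<Sum>k<N. if k = i then of_real (l k) * A $$ (k, j) else 0)"
    unfolding mat_mult_index[OF real_diag_mat_carrier assms(1,2,3)]
    by (intro sum.cong refl) (use assms in \<open>auto simp: real_diag_mat_index\<close>)
  then show ?thesis using assms(2) by simp
qed

lemma adjoint_mult_index:
  assumes "U \<in> carrier_mat N n" "V \<in> carrier_mat N m" "i < n" "j < m"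
  shows "(mat_adjoint U * V) $$ (i, j) = cip N (mcol U i) (mcol V j)"
  using assms unfolding mat_mult_index[OF mat_adjoint_carrier[OF assms(1)] assms(2-4)] cip_def mcol_def
  by (intro sum.cong refl) (simp add: mat_adjoint_index)

lemma unitary_mat_orthonormal:
  assumes "unitary_mat N U"
  shows "orthonormal_family N {..<N} (mcol U)"
  unfolding orthonormal_family_def
proof (intro ballI)
  fix a b assume ab: "a \<in> {..<N}" "b \<in> {..<N}"
  have U: "U \<in> carrier_mat N N" "mat_adjoint U * U = 1\<^sub>m N" using assms unfolding unitary_mat_def by auto
  have "cip N (mcol U a) (mcol U b) = (mat_adjoint U * U) $$ (a, b)"
    using adjoint_mult_index[OF U(1) U(1)] ab by simp
  then show "cip N (mcol U a) (mcol U b) = (if a = b then 1 else 0)"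
    unfolding U(2) using ab by simp
qed

lemma orthonormal_unitary_mat:
  assumes U: "U \<in> carrier_mat N N" and on: "orthonormal_family N {..<N} (mcol U)"
  shows "unitary_mat N U"
proof -
  have 1: "mat_adjoint U * U = 1\<^sub>m N"
  proof (rule eq_matI)
    fix i j assume "i < dim_row (1\<^sub>m N :: complex mat)" "j < dim_col (1\<^sub>m N :: complex mat)"
    then show "(mat_adjoint U * U) $$ (i, j) = 1\<^sub>m N $$ (i, j)"
      using on unfolding orthonormal_family_def by (simp add: adjoint_mult_index[OF U U])
  qed (use U carrier_matD[OF mat_adjoint_carrier[OF U]] in auto)
  moreover have "U * mat_adjoint U = 1\<^sub>m N"
    using mat_mult_left_right_inverse[OF mat_adjoint_carrier[OF U] U 1] .
  ultimately show ?thesis using U unfolding unitary_mat_def by blast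
qed

lemma hermitian_mat_index:
  "hermitian_mat N A \<Longrightarrow> i < N \<Longrightarrow> j < N \<Longrightarrow> A $$ (j, i) = cnj (A $$ (i, j))"
  unfolding hermitian_mat_def using mat_adjoint_index[of A N N j i] by auto

lemma hermitian_spectral_decomp:
  assumes "hermitian_mat N A"
  shows "\<exists>U l. spectral_decomp N A U l"
proof -
  have A: "A \<in> carrier_mat N N" using assms unfolding hermitian_mat_def by auto
  obtain e and l :: "nat \<Rightarrow> real" where e: "orthonormal_family N {..<N} e"
    and l: "\<And>k i. k < N \<Longrightarrow> i < N \<Longrightarrow> (\<Sum>j<N. A $$ (i, j) * e k j) = of_real (l k) * e k i"
    using spectral_theorem_fun[of N "\<lambda>i j. A $$ (i, j)"] hermitian_mat_index[OF assms] by blast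
  define U where "U = mat N N (\<lambda>(i, k). e k i)"
  have U: "U \<in> carrier_mat N N" unfolding U_def by simp
  have "orthonormal_family N {..<N} (mcol U)"
    using e unfolding orthonormal_family_def cip_def mcol_def U_def by simp
  then have un: "unitary_mat N U" by (rule orthonormal_unitary_mat[OF U])
  have "A * U = U * real_diag_mat N l"
  proof (rule eq_matI)
    fix i j assume "i < dim_row (U * real_diag_mat N l)" "j < dim_col (U * real_diag_mat N l)"
    then have ij: "i < N" "j < N" using U by (auto simp: real_diag_mat_def)
    then show "(A * U) $$ (i, j) = (U * real_diag_mat N l) $$ (i, j)"
      unfolding mat_mult_index[OF A U ij] mult_real_diag_index[OF U ij] using l by (simp add: U_def mult.commute)
  qed (use A U in \<open>auto simp: real_diag_mat_def\<close>)
  then have "A * U * mat_adjoint U = U * real_diag_mat N l * mat_adjoint U" by simp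
  moreover have "A * U * mat_adjoint U = A"
    using un A assoc_mult_mat[OF A U mat_adjoint_carrier[OF U]] unfolding unitary_mat_def by simp
  ultimately show ?thesis using un unfolding spectral_decomp_def by auto
qed

section \<open>Quadratic forms and the trace norm\<close>

text \<open>The probability of passing a projective test is a sum of \<open>qform\<close> over an
  orthonormal family, so no projection matrix has to be formed.\<close>

definition qform :: "nat \<Rightarrow> complex mat \<Rightarrow> (nat \<Rightarrow> complex) \<Rightarrow> real" where
  "qform N A v = Re (\<Sum>i<N. \<Sum>j<N. cnj (v i) * A $$ (i, j) * v j)"

lemma spectral_decomp_index:
  assumes "spectral_decomp N A U l" "i < N" "j < N"
  shows "A $$ (i, j) = (\<Sum>k<N. of_real (l k) * (U $$ (i, k) * cnj (U $$ (j, k))))"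
proof -
  have U: "U \<in> carrier_mat N N" and A: "A = U * real_diag_mat N l * mat_adjoint U"
    using assms unfolding spectral_decomp_def unitary_mat_def by auto
  have UD: "U * real_diag_mat N l \<in> carrier_mat N N" using U by (meson mult_carrier_mat real_diag_mat_carrier)
  show ?thesis
    unfolding A mat_mult_index[OF UD mat_adjoint_carrier[OF U] assms(2,3)]
    by (intro sum.cong refl)
      (simp add: mult_real_diag_index[OF U assms(2)] mat_adjoint_index[OF U _ assms(3)] mult_ac)
qed

lemma spectral_decomp_orthonormal:
  "spectral_decomp N A U l \<Longrightarrow> orthonormal_family N {..<N} (mcol U)"
  unfolding spectral_decomp_def by (blast intro: unitary_mat_orthonormal)

lemma spectral_decomp_carrier: "spectral_decomp N A U l \<Longrightarrow> A \<in> carrier_mat N N"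
  unfolding spectral_decomp_def unitary_mat_def
  by (metis mat_adjoint_carrier mult_carrier_mat real_diag_mat_carrier)

text \<open>Every linear functional of the entries of \<open>A\<close> expands over the rank-one
  eigenprojections; quadratic forms and traces of products are the two instances wanted.\<close>

lemma spectral_sum_eq:
  assumes "spectral_decomp N A U l"
  shows "(\<Sum>i<N. \<Sum>j<N. c i j * A $$ (i, j))
       = (\<Sum>k<N. of_real (l k) * (\<Sum>i<N. \<Sum>j<N. c i j * (U $$ (i, k) * cnj (U $$ (j, k)))))"
proof -
  have "(\<Sum>i<N. \<Sum>j<N. c i j * A $$ (i, j))
      = (\<Sum>i<N. \<Sum>j<N. \<Sum>k<N. of_real (l k) * (c i j * (U $$ (i, k) * cnj (U $$ (j, k)))))"
    by (intro sum.cong refl) (simp add: spectral_decomp_index[OF assms] sum_distrib_left mult_ac)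
  also have "\<dots> = (\<Sum>i<N. \<Sum>k<N. \<Sum>j<N. of_real (l k) * (c i j * (U $$ (i, k) * cnj (U $$ (j, k)))))"
    by (intro sum.cong refl sum.swap)
  also have "\<dots> = (\<Sum>k<N. \<Sum>i<N. \<Sum>j<N. of_real (l k) * (c i j * (U $$ (i, k) * cnj (U $$ (j, k)))))"
    by (rule sum.swap)
  finally show ?thesis unfolding sum_distrib_left .
qed

lemma qform_spectral:
  assumes "spectral_decomp N A U l"
  shows "qform N A v = (\<Sum>k<N. l k * (cmod (cip N (mcol U k) v))\<^sup>2)"
proof -
  have 1: "(\<Sum>i<N. \<Sum>j<N. cnj (v i) * v j * (U $$ (i, k) * cnj (U $$ (j, k))))
      = of_real ((cmod (cip N (mcol U k) v))\<^sup>2)" for k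
  proof -
    have "of_real ((cmod (cip N (mcol U k) v))\<^sup>2) = cip N v (mcol U k) * cip N (mcol U k) v"
      by (metis cip_mult_cnj mult.commute)
    also have "\<dots> = (\<Sum>i<N. \<Sum>j<N. cnj (v i) * v j * (U $$ (i, k) * cnj (U $$ (j, k))))"
      unfolding cip_def mcol_def sum_product by (simp only: mult_ac)
    finally show ?thesis ..
  qed
  have "(\<Sum>i<N. \<Sum>j<N. cnj (v i) * A $$ (i, j) * v j) = (\<Sum>i<N. \<Sum>j<N. cnj (v i) * v j * A $$ (i, j))"
    by (simp only: mult_ac)
  also have "\<dots> = of_real (\<Sum>k<N. l k * (cmod (cip N (mcol U k) v))\<^sup>2)"
    unfolding spectral_sum_eq[OF assms] 1 by simp
  finally show ?thesis unfolding qform_def by simp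
qed

lemma qform_mcol:
  assumes "spectral_decomp N A U l" "k < N"
  shows "qform N A (mcol U k) = l k"
proof -
  have "qform N A (mcol U k) = (\<Sum>j<N. if j = k then l j else 0)"
    unfolding qform_spectral[OF assms(1)] using spectral_decomp_orthonormal[OF assms(1)] assms(2)
    unfolding orthonormal_family_def by (intro sum.cong refl) auto
  then show ?thesis using assms(2) by simp
qed

lemma mtrace_mult_spectral:
  assumes "spectral_decomp N A U l" "B \<in> carrier_mat N N"
  shows "Re (mtrace (B * A)) = (\<Sum>k<N. l k * qform N B (mcol U k))"
proof -
  have A: "A \<in> carrier_mat N N" by (rule spectral_decomp_carrier[OF assms(1)])
  have "mtrace (B * A) = (\<Sum>i<N. \<Sum>j<N. B $$ (i, j) * A $$ (j, i))"
    unfolding mtrace_def using assms(2) by (auto intro!: sum.cong simp: mat_mult_index[OF assms(2) A])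
  also have "\<dots> = (\<Sum>j<N. \<Sum>i<N. B $$ (i, j) * A $$ (j, i))" by (rule sum.swap)
  also have "\<dots> = (\<Sum>k<N. of_real (l k) * (\<Sum>j<N. \<Sum>i<N. B $$ (i, j) * (U $$ (j, k) * cnj (U $$ (i, k)))))"
    by (rule spectral_sum_eq[OF assms(1)])
  also have "\<dots> = (\<Sum>k<N. of_real (l k) * (\<Sum>i<N. \<Sum>j<N. cnj (U $$ (i, k)) * B $$ (i, j) * U $$ (j, k)))"
    by (subst (2) sum.swap) (simp only: mult_ac)
  finally show ?thesis unfolding qform_def mcol_def by (simp add: Re_sum)
qed

lemma unitary_spectral_decomp_one: "unitary_mat N U \<Longrightarrow> spectral_decomp N (1\<^sub>m N) U (\<lambda>_. 1)"
proof -
  assume U: "unitary_mat N U"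
  have "real_diag_mat N (\<lambda>_. 1) = 1\<^sub>m N" by (rule eq_matI) (auto simp: real_diag_mat_def)
  moreover have "U * 1\<^sub>m N = U" using U right_mult_one_mat[of U N N] unfolding unitary_mat_def by blast
  ultimately show ?thesis using U unfolding spectral_decomp_def unitary_mat_def by simp
qed

text \<open>Every orthonormal basis is an eigenbasis of the identity.\<close>

lemma mtrace_eq_sum_qform:
  assumes "unitary_mat N U" "B \<in> carrier_mat N N"
  shows "Re (mtrace B) = (\<Sum>k<N. qform N B (mcol U k))"
  using mtrace_mult_spectral[OF unitary_spectral_decomp_one[OF assms(1)] assms(2)] assms(2) by simp

lemma mtrace_spectral:
  assumes "spectral_decomp N A U l"
  shows "Re (mtrace A) = (\<Sum>k<N. l k)"
proof -
  have "unitary_mat N U" using assms unfolding spectral_decomp_def by simp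
  then show ?thesis
    using mtrace_eq_sum_qform[of N U A] spectral_decomp_carrier[OF assms] qform_mcol[OF assms] by simp
qed

text \<open>\<open>mat_fun\<close> chooses some decomposition, so traces must be independent of the
  choice. The squared overlaps of the two eigenbases form a doubly stochastic matrix whose entries
  vanish unless the eigenvalues agree.\<close>

lemma spectral_trace_unique:
  fixes f :: "real \<Rightarrow> real"
  assumes "spectral_decomp N A U l" "spectral_decomp N A V m"
  shows "(\<Sum>k<N. f (l k)) = (\<Sum>k<N. f (m k))"
proof -
  have U: "unitary_mat N U" "U \<in> carrier_mat N N" "mat_adjoint U * U = 1\<^sub>m N"
    and V: "unitary_mat N V" "V \<in> carrier_mat N N" "mat_adjoint V * V = 1\<^sub>m N"
    using assms unfolding spectral_decomp_def unitary_mat_def by auto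
  have Ua: "mat_adjoint U \<in> carrier_mat N N" and Va: "mat_adjoint V \<in> carrier_mat N N" using U V by auto
  define X where "X = mat_adjoint U * V"
  have X: "X \<in> carrier_mat N N" unfolding X_def using Ua V(2) by simp
  let ?D = "real_diag_mat N l" and ?E = "real_diag_mat N m"
  have D: "?D \<in> carrier_mat N N" and E: "?E \<in> carrier_mat N N" by simp_all
  have A: "A \<in> carrier_mat N N" using spectral_decomp_carrier[OF assms(1)] .
  have "mat_adjoint U * A = ?D * mat_adjoint U"
  proof -
    have "mat_adjoint U * A = mat_adjoint U * (U * (?D * mat_adjoint U))"
      using assms(1) assoc_mult_mat[OF U(2) D Ua] unfolding spectral_decomp_def by simp
    also have "\<dots> = mat_adjoint U * U * (?D * mat_adjoint U)"
      using assoc_mult_mat[OF Ua U(2), of "?D * mat_adjoint U" N] mult_carrier_mat[OF D Ua] by simp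
    finally show ?thesis unfolding U(3) using left_mult_one_mat[OF mult_carrier_mat[OF D Ua]] by simp
  qed
  then have 1: "mat_adjoint U * A * V = ?D * X"
    unfolding X_def using assoc_mult_mat[OF D Ua V(2)] by simp
  have "A * V = V * ?E"
  proof -
    have "A * V = V * ?E * (mat_adjoint V * V)"
      using assms(2) assoc_mult_mat[OF mult_carrier_mat[OF V(2) E] Va V(2)] unfolding spectral_decomp_def by simp
    then show ?thesis unfolding V(3) using right_mult_one_mat[OF mult_carrier_mat[OF V(2) E]] by simp
  qed
  then have 2: "mat_adjoint U * A * V = X * ?E"
    unfolding X_def using assoc_mult_mat[OF Ua A V(2)] assoc_mult_mat[OF Ua V(2) E] by simp
  \<comment> \<open>Each entry of \<open>mat_adjoint U * A * V\<close> is the overlap times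
    \<open>l i\<close> when \<open>A\<close> acts to the left, and times \<open>m j\<close> when it
    acts to the right.\<close>
  have zero: "l i = m j \<or> cip N (mcol U i) (mcol V j) = 0" if "i < N" "j < N" for i j
  proof -
    have "of_real (l i) * X $$ (i, j) = X $$ (i, j) * of_real (m j)"
      using real_diag_mult_index[OF X that, of l] mult_real_diag_index[OF X that, of m] 1 2 by simp
    then show ?thesis
      unfolding X_def adjoint_mult_index[OF U(2) V(2) that] by (auto simp: mult.commute)
  qed
  have "(\<Sum>i<N. f (l i)) = (\<Sum>i<N. f (l i) * (\<Sum>j<N. (cmod (cip N (mcol V j) (mcol U i)))\<^sup>2))"
    using orthonormal_family_sqnorm[OF spectral_decomp_orthonormal[OF assms(1)]]
    by (simp add: parseval[OF spectral_decomp_orthonormal[OF assms(2)]])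
  also have "\<dots> = (\<Sum>i<N. \<Sum>j<N. f (m j) * (cmod (cip N (mcol U i) (mcol V j)))\<^sup>2)"
    unfolding sum_distrib_left
  proof (intro sum.cong refl)
    fix i j assume "i \<in> {..<N}" "j \<in> {..<N}"
    then show "f (l i) * (cmod (cip N (mcol V j) (mcol U i)))\<^sup>2 = f (m j) * (cmod (cip N (mcol U i) (mcol V j)))\<^sup>2"
      using zero[of i j] cmod_cip_commute[of N "mcol V j" "mcol U i"] by auto
  qed
  also have "\<dots> = (\<Sum>j<N. f (m j) * (\<Sum>i<N. (cmod (cip N (mcol U i) (mcol V j)))\<^sup>2))"
    unfolding sum_distrib_left by (rule sum.swap)
  also have "\<dots> = (\<Sum>j<N. f (m j))"
    using orthonormal_family_sqnorm[OF spectral_decomp_orthonormal[OF assms(2)]]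
    by (simp add: parseval[OF spectral_decomp_orthonormal[OF assms(1)]])
  finally show ?thesis .
qed

lemma mat_fun_spectral:
  assumes "hermitian_mat N A"
  obtains U l where "spectral_decomp N A U l" "spectral_decomp N (mat_fun N f A) U (f \<circ> l)"
proof -
  define Ul where "Ul = (SOME (U, l). unitary_mat N U \<and> A = U * real_diag_mat N l * mat_adjoint U)"
  obtain U l where Ul: "Ul = (U, l)" by (cases Ul)
  have "\<exists>z. case z of (U, l) \<Rightarrow> unitary_mat N U \<and> A = U * real_diag_mat N l * mat_adjoint U"
    using hermitian_spectral_decomp[OF assms] unfolding spectral_decomp_def by auto
  then have "case Ul of (U, l) \<Rightarrow> unitary_mat N U \<and> A = U * real_diag_mat N l * mat_adjoint U"
    unfolding Ul_def by (rule someI_ex)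
  then have 1: "unitary_mat N U" "A = U * real_diag_mat N l * mat_adjoint U" unfolding Ul by auto
  have "mat_fun N f A = U * real_diag_mat N (f \<circ> l) * mat_adjoint U"
    unfolding mat_fun_def Ul_def[symmetric] Ul by simp
  then show thesis using that[of U l] 1 unfolding spectral_decomp_def by simp
qed

lemma spectral_decomp_square:
  assumes "spectral_decomp N A U l"
  shows "spectral_decomp N (A * A) U (\<lambda>k. (l k)\<^sup>2)"
proof -
  have U: "unitary_mat N U" "U \<in> carrier_mat N N" "mat_adjoint U * U = 1\<^sub>m N"
    and Aeq: "A = U * real_diag_mat N l * mat_adjoint U"
    using assms unfolding spectral_decomp_def unitary_mat_def by auto
  have Ua: "mat_adjoint U \<in> carrier_mat N N" using U by auto
  let ?D = "real_diag_mat N l"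
  have D: "?D \<in> carrier_mat N N" by simp
  have UD: "U * ?D \<in> carrier_mat N N" and DU: "?D * mat_adjoint U \<in> carrier_mat N N"
    using mult_carrier_mat[OF U(2) D] mult_carrier_mat[OF D Ua] by auto
  have DD: "?D * ?D = real_diag_mat N (\<lambda>k. (l k)\<^sup>2)"
  proof (rule eq_matI)
    fix i j assume "i < dim_row (real_diag_mat N (\<lambda>k. (l k)\<^sup>2))" "j < dim_col (real_diag_mat N (\<lambda>k. (l k)\<^sup>2))"
    then have "i < N" "j < N" by (auto simp: real_diag_mat_def)
    then show "(?D * ?D) $$ (i, j) = real_diag_mat N (\<lambda>k. (l k)\<^sup>2) $$ (i, j)"
      by (simp only: mult_real_diag_index[OF D] real_diag_mat_index) (simp add: power2_eq_square)
  qed (auto simp: real_diag_mat_def)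
  have "A * A = (U * ?D) * (mat_adjoint U * A)"
    using Aeq assoc_mult_mat[OF UD Ua] spectral_decomp_carrier[OF assms] by metis
  also have "mat_adjoint U * A = mat_adjoint U * (U * (?D * mat_adjoint U))"
    unfolding Aeq assoc_mult_mat[OF U(2) D Ua] ..
  also have "\<dots> = ?D * mat_adjoint U"
    unfolding assoc_mult_mat[OF Ua U(2) DU, symmetric] U(3) by (rule left_mult_one_mat[OF DU])
  also have "U * ?D * (?D * mat_adjoint U) = U * ?D * ?D * mat_adjoint U"
    using assoc_mult_mat[OF UD D Ua] by simp
  also have "U * ?D * ?D = U * (?D * ?D)" by (rule assoc_mult_mat[OF U(2) D D])
  finally show ?thesis unfolding spectral_decomp_def DD using U by simp
qed

lemma hermitian_spectral_decomp_conv: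
  assumes "spectral_decomp N A U l"
  shows "hermitian_mat N A"
proof -
  have A: "A \<in> carrier_mat N N" using spectral_decomp_carrier[OF assms] .
  have "mat_adjoint A = A"
  proof (rule eq_matI)
    fix i j assume "i < dim_row A" "j < dim_col A"
    then have ij: "i < N" "j < N" using A by auto
    show "mat_adjoint A $$ (i, j) = A $$ (i, j)"
      unfolding mat_adjoint_index[OF A ij] spectral_decomp_index[OF assms ij] spectral_decomp_index[OF assms ij(2,1)]
      by (simp add: mult_ac)
  qed (use carrier_matD[OF A] carrier_matD[OF mat_adjoint_carrier[OF A]] in auto)
  then show ?thesis using A unfolding hermitian_mat_def by simp
qed

text \<open>The decomposition that \<open>mat_fun\<close> chooses for the square of \<open>A\<close>
  may differ from the one induced by \<open>U\<close>, hence the appeal to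
  \<open>spectral_trace_unique\<close>.\<close>

lemma trace_norm_spectral:
  assumes "spectral_decomp N A U l"
  shows "trace_norm N A = (\<Sum>k<N. \<bar>l k\<bar>)"
proof -
  have "mat_adjoint A = A" using hermitian_spectral_decomp_conv[OF assms] unfolding hermitian_mat_def by simp
  then have AA: "mat_adjoint A * A = A * A" by simp
  note sq = spectral_decomp_square[OF assms]
  obtain V m where V: "spectral_decomp N (A * A) V m" "spectral_decomp N (mat_fun N sqrt (A * A)) V (sqrt \<circ> m)"
    using mat_fun_spectral[OF hermitian_spectral_decomp_conv[OF sq]] by blast
  have "trace_norm N A = (\<Sum>k<N. sqrt (m k))"
    unfolding trace_norm_def AA mtrace_spectral[OF V(2)] by simp
  also have "\<dots> = (\<Sum>k<N. sqrt ((l k)\<^sup>2))" by (rule spectral_trace_unique[OF V(1) sq])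
  finally show ?thesis by simp
qed

text \<open>A test weighs each eigenvalue by a number \<open>s k\<close> between 0 and 1, so it
  collects at most the positive part. For trace zero the positive part carries half of the trace
  norm.\<close>

lemma trace_norm_ge_test:
  assumes "hermitian_mat N A" "Re (mtrace A) = 0" "finite I" "orthonormal_family N I e"
  shows "(\<Sum>a\<in>I. qform N A (e a)) \<le> trace_norm N A / 2"
proof -
  obtain U l where Ul: "spectral_decomp N A U l" using hermitian_spectral_decomp[OF assms(1)] by blast
  define s where "s = (\<lambda>k. \<Sum>a\<in>I. (cmod (cip N (e a) (mcol U k)))\<^sup>2)"
  have s: "0 \<le> s k" "k < N \<Longrightarrow> s k \<le> 1" for k
    using bessel[OF assms(3,4), of "mcol U k"]
      orthonormal_family_sqnorm[OF spectral_decomp_orthonormal[OF Ul], of k]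
    unfolding s_def by (auto intro: sum_nonneg)
  have "(\<Sum>a\<in>I. qform N A (e a)) = (\<Sum>k<N. \<Sum>a\<in>I. l k * (cmod (cip N (mcol U k) (e a)))\<^sup>2)"
    unfolding qform_spectral[OF Ul] by (rule sum.swap)
  also have "\<dots> = (\<Sum>k<N. l k * s k)"
    unfolding s_def sum_distrib_left by (simp only: cmod_cip_commute)
  also have "\<dots> \<le> (\<Sum>k<N. (\<bar>l k\<bar> + l k) / 2)"
  proof (rule sum_mono)
    fix k assume "k \<in> {..<N}"
    then have k: "s k \<le> 1" using s by simp
    show "l k * s k \<le> (\<bar>l k\<bar> + l k) / 2"
      using mult_left_mono[OF k, of "l k"] mult_nonpos_nonneg[of "l k" "s k"] s(1)[of k]
      by (cases "l k \<ge> 0") auto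
  qed
  also have "\<dots> = trace_norm N A / 2"
    using assms(2) unfolding mtrace_spectral[OF Ul] trace_norm_spectral[OF Ul]
    by (simp add: sum.distrib flip: sum_divide_distrib)
  finally show ?thesis .
qed

text \<open>In the eigenbasis of \<open>A\<close> each eigenvalue is a difference of two nonnegative
  numbers, and its modulus is at most their sum.\<close>

lemma trace_norm_diff_le:
  assumes "hermitian_mat N A" "B \<in> carrier_mat N N" "C \<in> carrier_mat N N"
    and "\<And>v. qform N A v = qform N B v - qform N C v"
    and "\<And>v. 0 \<le> qform N B v" "\<And>v. 0 \<le> qform N C v"
  shows "trace_norm N A \<le> Re (mtrace B) + Re (mtrace C)"
proof -
  obtain U l where Ul: "spectral_decomp N A U l" using hermitian_spectral_decomp[OF assms(1)] by blast
  then have U: "unitary_mat N U" unfolding spectral_decomp_def by simp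
  have "trace_norm N A = (\<Sum>k<N. \<bar>l k\<bar>)" by (rule trace_norm_spectral[OF Ul])
  also have "\<dots> \<le> (\<Sum>k<N. qform N B (mcol U k) + qform N C (mcol U k))"
  proof (rule sum_mono)
    fix k assume "k \<in> {..<N}"
    then have "l k = qform N B (mcol U k) - qform N C (mcol U k)"
      using qform_mcol[OF Ul] assms(4) by simp
    then show "\<bar>l k\<bar> \<le> qform N B (mcol U k) + qform N C (mcol U k)"
      using assms(5,6)[of "mcol U k"] by linarith
  qed
  finally show ?thesis
    by (simp add: sum.distrib mtrace_eq_sum_qform[OF U assms(2)] mtrace_eq_sum_qform[OF U assms(3)])
qed

section \<open>Tensor products and product distributions\<close>

text \<open>An index of a tensor product encodes the pair of its quotient and remainder by
  \<open>d\<close>, as in \<open>kron\<close>.\<close>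

lemma sum_div_mod:
  fixes f :: "nat \<Rightarrow> nat \<Rightarrow> 'a::comm_monoid_add"
  shows "(\<Sum>j<n * d. f (j div d) (j mod d)) = (\<Sum>a<n. \<Sum>b<d. f a b)"
proof (cases "d = 0")
  case False
  have lt: "a * d + b < n * d" if "a < n" "b < d" for a b
    using mult_le_mono1[of "Suc a" n d] that by simp
  show ?thesis
    unfolding sum.cartesian_product
    by (rule sum.reindex_bij_witness[of _ "\<lambda>(a, b). a * d + b" "\<lambda>j. (j div d, j mod d)"])
      (use False lt in \<open>auto simp: less_mult_imp_div_less\<close>)
qed simp

lemma div_mod_less:
  assumes "j < n * (d::nat)"
  shows "j div d < n" "j mod d < d"
  using assms by (cases "d = 0"; simp add: less_mult_imp_div_less)+

lemma kron_carrier: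
  "A \<in> carrier_mat n m \<Longrightarrow> B \<in> carrier_mat p q \<Longrightarrow> kron A B \<in> carrier_mat (n * p) (m * q)"
  unfolding kron_def by auto

lemma kron_index:
  "A \<in> carrier_mat n m \<Longrightarrow> B \<in> carrier_mat p q \<Longrightarrow> i < n * p \<Longrightarrow> j < m * q
   \<Longrightarrow> kron A B $$ (i, j) = A $$ (i div p, j div q) * B $$ (i mod p, j mod q)"
  unfolding kron_def by auto

lemma kron_mult:
  assumes A: "A \<in> carrier_mat n n" and B: "B \<in> carrier_mat d d"
    and C: "C \<in> carrier_mat n n" and D: "D \<in> carrier_mat d d"
  shows "kron A B * kron C D = kron (A * C) (B * D)"
proof (rule eq_matI)
  note AC = mult_carrier_mat[OF A C] and BD = mult_carrier_mat[OF B D]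
  fix i j assume "i < dim_row (kron (A * C) (B * D))" "j < dim_col (kron (A * C) (B * D))"
  then have ij: "i < n * d" "j < n * d" using carrier_matD[OF kron_carrier[OF AC BD]] by auto
  note d = div_mod_less[OF ij(1)] div_mod_less[OF ij(2)]
  have "(kron A B * kron C D) $$ (i, j)
      = (\<Sum>k<n * d. A $$ (i div d, k div d) * B $$ (i mod d, k mod d) * (C $$ (k div d, j div d) * D $$ (k mod d, j mod d)))"
    unfolding mat_mult_index[OF kron_carrier[OF A B] kron_carrier[OF C D] ij]
    by (intro sum.cong refl) (simp add: kron_index[OF A B] kron_index[OF C D] ij)
  also have "\<dots> = (\<Sum>a<n. \<Sum>b<d. A $$ (i div d, a) * B $$ (i mod d, b) * (C $$ (a, j div d) * D $$ (b, j mod d)))"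
    by (rule sum_div_mod)
  also have "\<dots> = (\<Sum>a<n. A $$ (i div d, a) * C $$ (a, j div d)) * (\<Sum>b<d. B $$ (i mod d, b) * D $$ (b, j mod d))"
    unfolding sum_product by (simp only: mult_ac)
  also have "\<dots> = kron (A * C) (B * D) $$ (i, j)"
    unfolding kron_index[OF AC BD ij] mat_mult_index[OF A C d(1,3)] mat_mult_index[OF B D d(2,4)] ..
  finally show "(kron A B * kron C D) $$ (i, j) = kron (A * C) (B * D) $$ (i, j)" .
qed (use A B C D in \<open>auto simp: kron_def\<close>)

lemma kron_adjoint:
  assumes A: "A \<in> carrier_mat n n" and B: "B \<in> carrier_mat d d"
  shows "mat_adjoint (kron A B) = kron (mat_adjoint A) (mat_adjoint B)"
proof (rule eq_matI)
  note A' = mat_adjoint_carrier[OF A] and B' = mat_adjoint_carrier[OF B]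
  fix i j assume "i < dim_row (kron (mat_adjoint A) (mat_adjoint B))" "j < dim_col (kron (mat_adjoint A) (mat_adjoint B))"
  then have ij: "i < n * d" "j < n * d" using carrier_matD[OF kron_carrier[OF A' B']] by auto
  note d = div_mod_less[OF ij(1)] div_mod_less[OF ij(2)]
  show "mat_adjoint (kron A B) $$ (i, j) = kron (mat_adjoint A) (mat_adjoint B) $$ (i, j)"
    unfolding mat_adjoint_index[OF kron_carrier[OF A B] ij] kron_index[OF A B ij(2,1)] kron_index[OF A' B' ij]
      mat_adjoint_index[OF A d(1,3)] mat_adjoint_index[OF B d(2,4)] by simp
qed (use carrier_matD[OF mat_adjoint_carrier[OF kron_carrier[OF A B]]]
      carrier_matD[OF kron_carrier[OF mat_adjoint_carrier[OF A] mat_adjoint_carrier[OF B]]] in auto)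

lemma kron_real_diag:
  "kron (real_diag_mat n l) (real_diag_mat d m) = real_diag_mat (n * d) (\<lambda>j. l (j div d) * m (j mod d))"
proof (rule eq_matI)
  fix i j assume "i < dim_row (real_diag_mat (n * d) (\<lambda>j. l (j div d) * m (j mod d)))"
    "j < dim_col (real_diag_mat (n * d) (\<lambda>j. l (j div d) * m (j mod d)))"
  then have ij: "i < n * d" "j < n * d" by (auto simp: real_diag_mat_def)
  note d = div_mod_less[OF ij(1)] div_mod_less[OF ij(2)]
  have "i = j \<longleftrightarrow> i div d = j div d \<and> i mod d = j mod d" by (metis div_mult_mod_eq)
  then show "kron (real_diag_mat n l) (real_diag_mat d m) $$ (i, j)
      = real_diag_mat (n * d) (\<lambda>j. l (j div d) * m (j mod d)) $$ (i, j)"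
    unfolding kron_index[OF real_diag_mat_carrier real_diag_mat_carrier ij]
    using d ij by (auto simp: real_diag_mat_index)
qed (auto simp: kron_def real_diag_mat_def)

lemma kron_one: "kron (1\<^sub>m n) (1\<^sub>m d) = (1\<^sub>m (n * d) :: complex mat)"
proof -
  have "real_diag_mat k (\<lambda>_. 1) = 1\<^sub>m k" for k
    by (rule eq_matI) (auto simp: real_diag_mat_def)
  then show ?thesis using kron_real_diag[of n "\<lambda>_. 1" d "\<lambda>_. 1"] by simp
qed

lemma kron_unitary:
  assumes "unitary_mat n U" "unitary_mat d V"
  shows "unitary_mat (n * d) (kron U V)"
proof -
  have U: "U \<in> carrier_mat n n" and V: "V \<in> carrier_mat d d" using assms unfolding unitary_mat_def by auto
  show ?thesis
    using assms unfolding unitary_mat_def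
    by (simp add: kron_carrier kron_adjoint[OF U V] kron_mult[of _ n _ d] kron_one)
qed

lemma kron_spectral:
  assumes "spectral_decomp n A U l" "spectral_decomp d B V m"
  shows "spectral_decomp (n * d) (kron A B) (kron U V) (\<lambda>j. l (j div d) * m (j mod d))"
proof -
  have U: "U \<in> carrier_mat n n" and V: "V \<in> carrier_mat d d"
    and AB: "A = U * real_diag_mat n l * mat_adjoint U" "B = V * real_diag_mat d m * mat_adjoint V"
    using assms unfolding spectral_decomp_def unitary_mat_def by auto
  have UD: "U * real_diag_mat n l \<in> carrier_mat n n" "V * real_diag_mat d m \<in> carrier_mat d d"
    using mult_carrier_mat[OF U real_diag_mat_carrier] mult_carrier_mat[OF V real_diag_mat_carrier] by auto
  have "kron A B = kron U V * real_diag_mat (n * d) (\<lambda>j. l (j div d) * m (j mod d)) * mat_adjoint (kron U V)"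
    unfolding AB kron_real_diag[symmetric] kron_adjoint[OF U V]
      kron_mult[OF U V real_diag_mat_carrier real_diag_mat_carrier]
      kron_mult[OF UD mat_adjoint_carrier[OF U] mat_adjoint_carrier[OF V]] ..
  then show ?thesis using assms kron_unitary unfolding spectral_decomp_def by blast
qed

lemma cip_kron:
  assumes U: "U \<in> carrier_mat n n" and V: "V \<in> carrier_mat d d"
    and G: "G \<in> carrier_mat n n" and H: "H \<in> carrier_mat d d" and jk: "j < n * d" "k < n * d"
  shows "cip (n * d) (mcol (kron U V) j) (mcol (kron G H) k)
       = cip n (mcol U (j div d)) (mcol G (k div d)) * cip d (mcol V (j mod d)) (mcol H (k mod d))"
proof -
  have "cip (n * d) (mcol (kron U V) j) (mcol (kron G H) k)
      = (\<Sum>i<n * d. cnj (U $$ (i div d, j div d) * V $$ (i mod d, j mod d)) * (G $$ (i div d, k div d) * H $$ (i mod d, k mod d)))"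
    unfolding cip_def mcol_def by (intro sum.cong refl) (simp add: kron_index[OF U V] kron_index[OF G H] jk)
  also have "\<dots> = (\<Sum>a<n. \<Sum>b<d. cnj (U $$ (a, j div d) * V $$ (b, j mod d)) * (G $$ (a, k div d) * H $$ (b, k mod d)))"
    by (rule sum_div_mod)
  also have "\<dots> = cip n (mcol U (j div d)) (mcol G (k div d)) * cip d (mcol V (j mod d)) (mcol H (k mod d))"
    unfolding cip_def mcol_def sum_product by (simp only: complex_cnj_mult mult_ac)
  finally show ?thesis .
qed

text \<open>Overlaps of product vectors factorise, so the sum over the product eigenbasis splits
  into a product of two sums.\<close>

lemma qform_kron:
  assumes A: "spectral_decomp n A U l" and B: "spectral_decomp d B V m"
    and G: "G \<in> carrier_mat n n" and H: "H \<in> carrier_mat d d" and k: "k < n * d"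
  shows "qform (n * d) (kron A B) (mcol (kron G H) k)
       = qform n A (mcol G (k div d)) * qform d B (mcol H (k mod d))"
proof -
  have U: "U \<in> carrier_mat n n" and V: "V \<in> carrier_mat d d"
    using A B unfolding spectral_decomp_def unitary_mat_def by auto
  have "qform (n * d) (kron A B) (mcol (kron G H) k)
      = (\<Sum>j<n * d. (l (j div d) * (cmod (cip n (mcol U (j div d)) (mcol G (k div d))))\<^sup>2)
          * (m (j mod d) * (cmod (cip d (mcol V (j mod d)) (mcol H (k mod d))))\<^sup>2))"
    unfolding qform_spectral[OF kron_spectral[OF A B]]
  proof (intro sum.cong refl)
    fix j assume "j \<in> {..<n * d}"
    then have j: "j < n * d" by simp
    show "l (j div d) * m (j mod d) * (cmod (cip (n * d) (mcol (kron U V) j) (mcol (kron G H) k)))\<^sup>2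
      = (l (j div d) * (cmod (cip n (mcol U (j div d)) (mcol G (k div d))))\<^sup>2)
          * (m (j mod d) * (cmod (cip d (mcol V (j mod d)) (mcol H (k mod d))))\<^sup>2)"
      unfolding cip_kron[OF U V G H j k] norm_mult power_mult_distrib by (simp only: mult_ac)
  qed
  also have "\<dots> = qform n A (mcol G (k div d)) * qform d B (mcol H (k mod d))"
    unfolding qform_spectral[OF A] qform_spectral[OF B] sum_product by (rule sum_div_mod)
  finally show ?thesis .
qed

section \<open>Product distributions on words and Chebyshev's inequality\<close>

fun word_prod :: "nat \<Rightarrow> ('y \<Rightarrow> nat \<Rightarrow> real) \<Rightarrow> nat \<Rightarrow> (nat \<Rightarrow> 'y) \<Rightarrow> nat \<Rightarrow> real" where
  "word_prod d w 0 c j = 1"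
| "word_prod d w (Suc n) c j = word_prod d w n c (j div d) * w (c n) (j mod d)"

text \<open>As in \<open>word_prod\<close>, \<open>j\<close> codes a word of \<open>n\<close> digits
  in base \<open>d\<close> whose last letter is the lowest digit. The codeword \<open>c\<close>
  selects the law and the statistic of each digit, so that under \<open>word_prod\<close> this is a
  sum of independent variables.\<close>

fun word_sum :: "nat \<Rightarrow> ('y \<Rightarrow> nat \<Rightarrow> real) \<Rightarrow> nat \<Rightarrow> (nat \<Rightarrow> 'y) \<Rightarrow> nat \<Rightarrow> real" where
  "word_sum d t 0 c j = 0"
| "word_sum d t (Suc n) c j = word_sum d t n c (j div d) + t (c n) (j mod d)"

lemma tensor_word_carrier:
  assumes "\<And>x. W x \<in> carrier_mat d d"
  shows "tensor_word W n c \<in> carrier_mat (d ^ n) (d ^ n)"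
  by (induction n) (auto simp: assms kron_carrier power_Suc2 simp del: power_Suc)

lemma tensor_word_const: "tensor_word (\<lambda>_. A) n c = tensor_power A n"
  unfolding tensor_power_def by (induction n) auto

lemma tensor_word_spectral:
  assumes "\<And>x. spectral_decomp d (W x) (U x) (l x)"
  shows "spectral_decomp (d ^ n) (tensor_word W n c) (tensor_word U n c) (word_prod d l n c)"
proof (induction n)
  case 0
  have "mat_adjoint (1\<^sub>m 1 :: complex mat) = 1\<^sub>m 1"
    by (rule eq_matI) (use mat_adjoint_index[of "1\<^sub>m 1 :: complex mat" 1 1 0 0] in \<open>auto simp: mat_adjoint_def\<close>)
  then have "unitary_mat 1 (1\<^sub>m 1)" unfolding unitary_mat_def by simp
  from unitary_spectral_decomp_one[OF this] show ?case
    unfolding tensor_word.simps power_0 by (simp add: spectral_decomp_def real_diag_mat_def)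
next
  case (Suc n)
  have "word_prod d l (Suc n) c = (\<lambda>j. word_prod d l n c (j div d) * l (c n) (j mod d))" by auto
  then show ?case
    unfolding tensor_word.simps power_Suc2 using kron_spectral[OF Suc assms] by simp
qed

lemma tensor_word_unitary:
  assumes "\<And>x. unitary_mat d (U x)"
  shows "unitary_mat (d ^ n) (tensor_word U n c)"
  using tensor_word_spectral[of d "\<lambda>_. 1\<^sub>m d" U "\<lambda>_ _. 1" n c] unitary_spectral_decomp_one[OF assms]
  unfolding spectral_decomp_def by blast

text \<open>Measuring a product state in a product basis gives independent outcomes. This reduces
  the quantum estimates to sums of independent variables.\<close>

lemma qform_tensor_word:
  assumes "\<And>x. spectral_decomp d (W x) (U x) (l x)" "\<And>x. G x \<in> carrier_mat d d" "k < d ^ n"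
  shows "qform (d ^ n) (tensor_word W n c) (mcol (tensor_word G n c) k)
       = word_prod d (\<lambda>x k. qform d (W x) (mcol (G x) k)) n c k"
  using assms(3)
proof (induction n arbitrary: k)
  case 0
  then show ?case by (simp add: qform_def mcol_def)
next
  case (Suc n)
  then have k: "k < d ^ n * d" by (simp add: mult.commute)
  show ?case
    unfolding tensor_word.simps power_Suc2
      qform_kron[OF tensor_word_spectral[OF assms(1)] assms(1) tensor_word_carrier[OF assms(2)] assms(2) k]
    using Suc.IH[OF div_mod_less(1)[OF k]] by simp
qed

lemma word_prod_nonneg:
  assumes "\<And>x b. b < d \<Longrightarrow> 0 \<le> w x b" "j < d ^ n"
  shows "0 \<le> word_prod d w n c j"
  using assms(2)
proof (induction n arbitrary: j)
  case (Suc n)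
  then have "j < d ^ n * d" by (simp add: mult.commute)
  from Suc.IH[OF div_mod_less(1)[OF this]] assms(1)[OF div_mod_less(2)[OF this]] show ?case by simp
qed simp

text \<open>The function \<open>f\<close> of probability and statistic lets the total mass and both
  moments follow from one recursion.\<close>

lemma sum_word_Suc:
  fixes f :: "real \<Rightarrow> real \<Rightarrow> real"
  shows "(\<Sum>j<d ^ Suc n. f (word_prod d w (Suc n) c j) (word_sum d t (Suc n) c j))
    = (\<Sum>a<d ^ n. \<Sum>b<d. f (word_prod d w n c a * w (c n) b) (word_sum d t n c a + t (c n) b))"
  unfolding power_Suc2 word_prod.simps word_sum.simps by (rule sum_div_mod)

lemma word_prod_sum:
  assumes "\<And>x. (\<Sum>b<d. w x b) = 1"
  shows "(\<Sum>j<d ^ n. word_prod d w n c j) = 1"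
proof (induction n)
  case (Suc n)
  have "(\<Sum>j<d ^ Suc n. word_prod d w (Suc n) c j) = (\<Sum>a<d ^ n. \<Sum>b<d. word_prod d w n c a * w (c n) b)"
    using sum_word_Suc[of "\<lambda>x y. x" d w n c] by simp
  then show ?case by (simp only: sum_distrib_left[symmetric] assms Suc mult_1_right)
qed simp

text \<open>Variances of independent centred variables add. Both moments are treated in one
  induction because the cross term of the second contains the first.\<close>

lemma word_sum_moments:
  assumes "\<And>x. (\<Sum>b<d. w x b) = 1" "\<And>x. (\<Sum>b<d. w x b * t x b) = 0"
    and "\<And>x. (\<Sum>b<d. w x b * (t x b)\<^sup>2) \<le> V"
  shows "(\<Sum>j<d ^ n. word_prod d w n c j * word_sum d t n c j) = 0"
    and "(\<Sum>j<d ^ n. word_prod d w n c j * (word_sum d t n c j)\<^sup>2) \<le> real n * V"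
proof (induction n)
  case 0
  case 1 show ?case by simp
  case 2 show ?case by simp
next
  case (Suc n)
  let ?p = "word_prod d w n c" and ?s = "word_sum d t n c" and ?w = "w (c n)" and ?t = "t (c n)"
  have p1: "(\<Sum>a<d ^ n. ?p a) = 1" by (rule word_prod_sum[OF assms(1)])
  {
    case 1
    have "(\<Sum>j<d ^ Suc n. word_prod d w (Suc n) c j * word_sum d t (Suc n) c j)
        = (\<Sum>a<d ^ n. \<Sum>b<d. ?p a * ?w b * (?s a + ?t b))" by (rule sum_word_Suc)
    also have "\<dots> = (\<Sum>a<d ^ n. ?p a * ?s a) * (\<Sum>b<d. ?w b) + (\<Sum>a<d ^ n. ?p a) * (\<Sum>b<d. ?w b * ?t b)"
      unfolding sum_product by (simp add: algebra_simps sum.distrib)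
    finally show ?case using Suc(1) assms by simp
  next
    case 2
    have "(\<Sum>j<d ^ Suc n. word_prod d w (Suc n) c j * (word_sum d t (Suc n) c j)\<^sup>2)
        = (\<Sum>a<d ^ n. \<Sum>b<d. ?p a * ?w b * (?s a + ?t b)\<^sup>2)"
      using sum_word_Suc[of "\<lambda>x y. x * y\<^sup>2" d w n c t] .
    also have "\<dots> = (\<Sum>a<d ^ n. \<Sum>b<d. ?p a * (?s a)\<^sup>2 * ?w b + 2 * (?p a * ?s a * (?w b * ?t b)) + ?p a * (?w b * (?t b)\<^sup>2))"
      by (intro sum.cong refl) (simp add: algebra_simps power2_eq_square)
    also have "\<dots> = (\<Sum>a<d ^ n. ?p a * (?s a)\<^sup>2) * (\<Sum>b<d. ?w b)
        + 2 * ((\<Sum>a<d ^ n. ?p a * ?s a) * (\<Sum>b<d. ?w b * ?t b)) + (\<Sum>a<d ^ n. ?p a) * (\<Sum>b<d. ?w b * (?t b)\<^sup>2)"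
      unfolding sum_product sum.distrib by (simp only: sum_distrib_left)
    finally show ?case using Suc assms(1,2) assms(3)[of "c n"] p1 by (simp add: algebra_simps)
  }
qed

lemma word_sum_center:
  "word_sum d (\<lambda>x b. t x b - m x) n c j = word_sum d t n c j - (\<Sum>i<n. m (c i))"
  by (induction n arbitrary: j) auto

text \<open>Markov's inequality for the square of the centred sum. As \<open>V\<close> bounds the
  variance for every letter, the estimate is uniform in the codeword.\<close>

lemma word_sum_chebyshev:
  fixes w t :: "'y \<Rightarrow> nat \<Rightarrow> real"
  assumes w: "\<And>x b. b < d \<Longrightarrow> 0 \<le> w x b" "\<And>x. (\<Sum>b<d. w x b) = 1"
    and m: "\<And>x. m x = (\<Sum>b<d. w x b * t x b)"
    and V: "\<And>x. (\<Sum>b<d. w x b * (t x b - m x)\<^sup>2) \<le> V"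
    and n: "0 < n" and \<epsilon>: "0 < \<epsilon>"
    and B: "B \<subseteq> {..<d ^ n}" "\<And>j. j \<in> B \<Longrightarrow> real n * \<epsilon> \<le> \<bar>word_sum d t n c j - (\<Sum>i<n. m (c i))\<bar>"
  shows "(\<Sum>j\<in>B. word_prod d w n c j) \<le> V / (real n * \<epsilon>\<^sup>2)"
proof -
  let ?s = "word_sum d (\<lambda>x b. t x b - m x) n c" and ?p = "word_prod d w n c"
  have "(\<Sum>b<d. w x b * (t x b - m x)) = 0" for x
    using m[of x] w(2)[of x] by (simp add: right_diff_distrib sum_subtractf flip: sum_distrib_right)
  note mom = word_sum_moments(2)[of w d "\<lambda>x b. t x b - m x", OF w(2) this V]
  have pos: "0 \<le> ?p j" if "j < d ^ n" for j using word_prod_nonneg[OF w(1) that] .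
  have "(\<Sum>j\<in>B. ?p j) * (real n * \<epsilon>)\<^sup>2 \<le> (\<Sum>j\<in>B. ?p j * (?s j)\<^sup>2)"
    unfolding sum_distrib_right
  proof (rule sum_mono)
    fix j assume j: "j \<in> B"
    then have "real n * \<epsilon> \<le> \<bar>?s j\<bar>" using B(2) by (simp add: word_sum_center)
    then have "(real n * \<epsilon>)\<^sup>2 \<le> (?s j)\<^sup>2" using n \<epsilon> by (intro abs_le_square_iff[THEN iffD1]) simp
    then show "?p j * (real n * \<epsilon>)\<^sup>2 \<le> ?p j * (?s j)\<^sup>2"
      using pos j B(1) by (intro mult_left_mono) auto
  qed
  also have "\<dots> \<le> (\<Sum>j<d ^ n. ?p j * (?s j)\<^sup>2)"
    using B(1) pos by (intro sum_mono2) auto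
  also have "\<dots> \<le> real n * V" by (rule mom)
  finally show ?thesis using n \<epsilon> by (simp add: field_simps power2_eq_square)
qed

section \<open>The test\<close>

text \<open>The entrywise hypothesis makes \<open>avg_state\<close>, \<open>codebook_state\<close>
  and, with \<open>bool\<close> as index type, differences of two matrices instances of one lemma;
  the three lemmas that follow share this form.\<close>

lemma hermitian_lincomb:
  fixes c :: "'i \<Rightarrow> real"
  assumes "A \<in> carrier_mat N N" "\<And>x. x \<in> X \<Longrightarrow> hermitian_mat N (B x)"
    and "\<And>i j. i < N \<Longrightarrow> j < N \<Longrightarrow> A $$ (i, j) = (\<Sum>x\<in>X. of_real (c x) * B x $$ (i, j))"
  shows "hermitian_mat N A"
proof -
  have "mat_adjoint A = A"
  proof (rule eq_matI)
    fix i j assume "i < dim_row A" "j < dim_col A"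
    then have ij: "i < N" "j < N" using assms(1) by auto
    have "B x $$ (i, j) = cnj (B x $$ (j, i))" if "x \<in> X" for x
      using hermitian_mat_index[OF assms(2)[OF that] ij(2,1)] .
    then show "mat_adjoint A $$ (i, j) = A $$ (i, j)"
      unfolding mat_adjoint_index[OF assms(1) ij] using ij by (simp add: assms(3))
  qed (use carrier_matD[OF assms(1)] carrier_matD[OF mat_adjoint_carrier[OF assms(1)]] in auto)
  then show ?thesis using assms(1) unfolding hermitian_mat_def by simp
qed

lemma qform_lincomb:
  fixes c :: "'i \<Rightarrow> real"
  assumes "\<And>i j. i < N \<Longrightarrow> j < N \<Longrightarrow> A $$ (i, j) = (\<Sum>x\<in>X. of_real (c x) * B x $$ (i, j))"
  shows "qform N A v = (\<Sum>x\<in>X. c x * qform N (B x) v)"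
proof -
  have "(\<Sum>i<N. \<Sum>j<N. cnj (v i) * A $$ (i, j) * v j)
      = (\<Sum>i<N. \<Sum>j<N. \<Sum>x\<in>X. of_real (c x) * (cnj (v i) * B x $$ (i, j) * v j))"
    by (intro sum.cong refl) (simp add: assms sum_distrib_left sum_distrib_right mult_ac)
  also have "\<dots> = (\<Sum>i<N. \<Sum>x\<in>X. \<Sum>j<N. of_real (c x) * (cnj (v i) * B x $$ (i, j) * v j))"
    by (intro sum.cong refl sum.swap)
  also have "\<dots> = (\<Sum>x\<in>X. \<Sum>i<N. \<Sum>j<N. of_real (c x) * (cnj (v i) * B x $$ (i, j) * v j))"
    by (rule sum.swap)
  finally show ?thesis unfolding qform_def by (simp add: Re_sum flip: sum_distrib_left)
qed

lemma mtrace_lincomb: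
  fixes c :: "'i \<Rightarrow> real"
  assumes "A \<in> carrier_mat N N" "\<And>x. x \<in> X \<Longrightarrow> B x \<in> carrier_mat N N"
    and "\<And>i j. i < N \<Longrightarrow> j < N \<Longrightarrow> A $$ (i, j) = (\<Sum>x\<in>X. of_real (c x) * B x $$ (i, j))"
  shows "mtrace A = (\<Sum>x\<in>X. of_real (c x) * mtrace (B x))"
proof -
  have "mtrace A = (\<Sum>i<N. \<Sum>x\<in>X. of_real (c x) * B x $$ (i, i))"
    unfolding mtrace_def using assms by simp
  also have "\<dots> = (\<Sum>x\<in>X. \<Sum>i<N. of_real (c x) * B x $$ (i, i))" by (rule sum.swap)
  also have "\<dots> = (\<Sum>x\<in>X. of_real (c x) * mtrace (B x))"
  proof (intro sum.cong refl)
    fix x assume "x \<in> X"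
    then have "dim_row (B x) = N" using assms(2) by auto
    then show "(\<Sum>i<N. of_real (c x) * B x $$ (i, i)) = of_real (c x) * mtrace (B x)"
      unfolding mtrace_def sum_distrib_left by simp
  qed
  finally show ?thesis .
qed

lemma mtrace_mult_lincomb:
  fixes c :: "'i \<Rightarrow> real"
  assumes "D \<in> carrier_mat N N" "A \<in> carrier_mat N N" "\<And>x. x \<in> X \<Longrightarrow> B x \<in> carrier_mat N N"
    and "\<And>i j. i < N \<Longrightarrow> j < N \<Longrightarrow> A $$ (i, j) = (\<Sum>x\<in>X. of_real (c x) * B x $$ (i, j))"
  shows "mtrace (D * A) = (\<Sum>x\<in>X. of_real (c x) * mtrace (D * B x))"
proof (rule mtrace_lincomb)
  fix i j assume ij: "i < N" "j < N"
  have "(D * A) $$ (i, j) = (\<Sum>k<N. \<Sum>x\<in>X. of_real (c x) * (D $$ (i, k) * B x $$ (k, j)))"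
    unfolding mat_mult_index[OF assms(1,2) ij]
    by (intro sum.cong refl) (simp add: assms(4) ij sum_distrib_left mult_ac)
  also have "\<dots> = (\<Sum>x\<in>X. \<Sum>k<N. of_real (c x) * (D $$ (i, k) * B x $$ (k, j)))" by (rule sum.swap)
  also have "\<dots> = (\<Sum>x\<in>X. of_real (c x) * (D * B x) $$ (i, j))"
    by (intro sum.cong refl) (simp only: mat_mult_index[OF assms(1) assms(3) ij] sum_distrib_left)
  finally show "(D * A) $$ (i, j) = (\<Sum>x\<in>X. of_real (c x) * (D * B x) $$ (i, j))" .
qed (use assms in auto)

text \<open>The test is the span of the columns of \<open>G\<close> in \<open>S\<close> and of the
  eigenvectors in the sets \<open>J\<close>. The state \<open>\<sigma>\<close> has weight at most
  \<open>\<epsilon>1\<close> on the first part. On the rest it has at most \<open>\<tau>\<close> per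
  added vector, plus the total \<open>\<epsilon>0\<close> of its eigenvalues above
  \<open>\<tau>\<close>.\<close>

lemma resolvability_test:
  fixes M :: nat and K \<tau> :: real
  assumes \<sigma>: "spectral_decomp N \<sigma> F \<mu>" "\<And>k. k < N \<Longrightarrow> 0 \<le> \<mu> k"
    and \<tau>: "0 \<le> \<tau>" "(\<Sum>k | k < N \<and> \<tau> < \<mu> k. \<mu> k) \<le> \<epsilon>0"
    and G: "unitary_mat N G" and S: "S \<subseteq> {..<N}" "(\<Sum>k\<in>S. qform N \<sigma> (mcol G k)) \<le> \<epsilon>1"
    and M: "1 \<le> M" and K: "0 \<le> K"
    and \<rho>: "\<And>m. m \<in> {1..M} \<Longrightarrow> spectral_decomp N (\<rho> m) (U m) (l m)"
      "\<And>m k. m \<in> {1..M} \<Longrightarrow> k < N \<Longrightarrow> 0 \<le> l m k"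
    and word: "\<And>m. m \<in> {1..M} \<Longrightarrow> 1 - \<epsilon> \<le> (\<Sum>k\<in>S. qform N (\<rho> m) (mcol G k))
      \<or> (\<exists>J\<subseteq>{..<N}. real (card J) \<le> K \<and> 1 - \<epsilon> \<le> (\<Sum>j\<in>J. l m j))"
    and \<Delta>: "hermitian_mat N \<Delta>" "Re (mtrace \<Delta>) = 0"
      "\<And>v. qform N \<Delta> v = (\<Sum>m=1..M. qform N (\<rho> m) v) / real M - qform N \<sigma> v"
  shows "1 - \<epsilon> - \<epsilon>1 - \<epsilon>0 - real M * K * \<tau> \<le> trace_norm N \<Delta> / 2"
proof -
  \<comment> \<open>Codewords detected by \<open>S\<close> receive the empty set, so that one choice
    function covers both kinds.\<close>
  have "\<exists>J\<subseteq>{..<N}. real (card J) \<le> K \<and>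
      (1 - \<epsilon> \<le> (\<Sum>k\<in>S. qform N (\<rho> m) (mcol G k)) \<or> 1 - \<epsilon> \<le> (\<Sum>j\<in>J. l m j))" if "m \<in> {1..M}" for m
  proof (cases "1 - \<epsilon> \<le> (\<Sum>k\<in>S. qform N (\<rho> m) (mcol G k))")
    case True
    then show ?thesis using K by (intro exI[of _ "{}"]) auto
  next
    case False
    then show ?thesis using word[OF that] by blast
  qed
  then obtain J where J: "\<And>m. m \<in> {1..M} \<Longrightarrow> J m \<subseteq> {..<N}" "\<And>m. m \<in> {1..M} \<Longrightarrow> real (card (J m)) \<le> K"
    "\<And>m. m \<in> {1..M} \<Longrightarrow> 1 - \<epsilon> \<le> (\<Sum>k\<in>S. qform N (\<rho> m) (mcol G k)) \<or> 1 - \<epsilon> \<le> (\<Sum>j\<in>J m. l m j)"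
    by metis
  have finJ: "finite (J m)" if "m \<in> {1..M}" for m using J(1)[OF that] finite_subset by blast
  define L where "L = (\<Union>m\<in>{1..M}. mcol (U m) ` J m)"
  have finL: "finite L" unfolding L_def using finJ by blast
  have cardL: "real (card L) \<le> real M * K"
  proof -
    have "card L \<le> (\<Sum>m\<in>{1..M}. card (mcol (U m) ` J m))" unfolding L_def by (rule card_UN_le) simp
    also have "\<dots> \<le> (\<Sum>m\<in>{1..M}. card (J m))" using finJ by (intro sum_mono card_image_le)
    finally have "real (card L) \<le> (\<Sum>m\<in>{1..M}. real (card (J m)))" by (metis of_nat_le_iff of_nat_sum)
    also have "\<dots> \<le> (\<Sum>m\<in>{1..M}. K)" using J(2) by (intro sum_mono)
    finally show ?thesis by simp
  qed
  have finS: "finite S" using S(1) finite_subset by blast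
  have onS: "orthonormal_family N S (mcol G)"
    using unitary_mat_orthonormal[OF G] S(1) unfolding orthonormal_family_def by blast
  obtain R f where R: "finite R" "S \<inter> R = {}" "card R \<le> card L" and on: "orthonormal_family N (S \<union> R) f"
    and fS: "\<And>a. a \<in> S \<Longrightarrow> f a = mcol G a"
    and fL: "\<And>v. v \<in> L \<Longrightarrow> (\<Sum>a\<in>S \<union> R. (cmod (cip N (f a) v))\<^sup>2) = sqnorm N v"
    using extend_orthonormal_family[OF finL finS onS] by blast
  have fin: "finite (S \<union> R)" using finS R(1) by simp
  \<comment> \<open>The weight of a state on a family, evaluated in the eigenbasis of the
    state.\<close>
  have swap: "(\<Sum>a\<in>I. qform N A (f a)) = (\<Sum>k<N. m k * (\<Sum>a\<in>I. (cmod (cip N (f a) (mcol V k)))\<^sup>2))"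
    if "spectral_decomp N A V m" for A V m I
    unfolding qform_spectral[OF that] sum_distrib_left
    by (subst sum.swap) (simp only: cmod_cip_commute)
  have code: "1 - \<epsilon> \<le> (\<Sum>a\<in>S \<union> R. qform N (\<rho> m) (f a))" if m: "m \<in> {1..M}" for m
    using J(3)[OF m]
  proof
    assume "1 - \<epsilon> \<le> (\<Sum>k\<in>S. qform N (\<rho> m) (mcol G k))"
    also have "\<dots> = (\<Sum>k\<in>S. qform N (\<rho> m) (f k))" using fS by simp
    also have "\<dots> \<le> (\<Sum>a\<in>S \<union> R. qform N (\<rho> m) (f a))"
      using fin \<rho>(2)[OF m] by (intro sum_mono2) (auto simp: qform_spectral[OF \<rho>(1)[OF m]] intro!: sum_nonneg)
    finally show ?thesis .
  next
    assume "1 - \<epsilon> \<le> (\<Sum>j\<in>J m. l m j)"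
    \<comment> \<open>The selected eigenvectors lie in the span of the test, so each inserted factor
      is 1.\<close>
    also have "\<dots> = (\<Sum>j\<in>J m. l m j * (\<Sum>a\<in>S \<union> R. (cmod (cip N (f a) (mcol (U m) j)))\<^sup>2))"
    proof (intro sum.cong refl)
      fix j assume j: "j \<in> J m"
      have "sqnorm N (mcol (U m) j) = 1"
        using orthonormal_family_sqnorm[OF spectral_decomp_orthonormal[OF \<rho>(1)[OF m]]] J(1)[OF m] j by blast
      moreover have "mcol (U m) j \<in> L" unfolding L_def using m j by blast
      ultimately show "l m j = l m j * (\<Sum>a\<in>S \<union> R. (cmod (cip N (f a) (mcol (U m) j)))\<^sup>2)"
        using fL by simp
    qed
    also have "\<dots> \<le> (\<Sum>j<N. l m j * (\<Sum>a\<in>S \<union> R. (cmod (cip N (f a) (mcol (U m) j)))\<^sup>2))"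
      using J(1)[OF m] \<rho>(2)[OF m] by (intro sum_mono2) (auto intro!: mult_nonneg_nonneg sum_nonneg)
    also have "\<dots> = (\<Sum>a\<in>S \<union> R. qform N (\<rho> m) (f a))" by (rule swap[OF \<rho>(1)[OF m], symmetric])
    finally show ?thesis .
  qed
  have "(\<Sum>a\<in>R. qform N \<sigma> (f a)) \<le> real M * K * \<tau> + \<epsilon>0"
  proof -
    define s where "s = (\<lambda>k. \<Sum>a\<in>R. (cmod (cip N (f a) (mcol F k)))\<^sup>2)"
    have onF: "orthonormal_family N {..<N} (mcol F)" by (rule spectral_decomp_orthonormal[OF \<sigma>(1)])
    have onR: "orthonormal_family N R f" using on unfolding orthonormal_family_def by blast
    have s: "0 \<le> s k" "k < N \<Longrightarrow> s k \<le> 1" for k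
      using bessel[OF R(1) onR, of "mcol F k"] orthonormal_family_sqnorm[OF onF, of k]
      unfolding s_def by (auto intro: sum_nonneg)
    have ssum: "(\<Sum>k<N. s k) = real (card R)"
    proof -
      have "(\<Sum>k<N. s k) = (\<Sum>a\<in>R. \<Sum>k<N. (cmod (cip N (mcol F k) (f a)))\<^sup>2)"
        unfolding s_def by (subst sum.swap) (simp only: cmod_cip_commute)
      then show ?thesis
        using orthonormal_family_sqnorm[OF onR] by (simp add: parseval[OF onF])
    qed
    have "(\<Sum>a\<in>R. qform N \<sigma> (f a)) = (\<Sum>k<N. \<mu> k * s k)" unfolding s_def by (rule swap[OF \<sigma>(1)])
    \<comment> \<open>An eigenvalue of at most \<open>\<tau>\<close> is charged to the first summand
      and a larger one, since \<open>s k\<close> is at most 1, to the second. The \<open>s k\<close>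
      add up to \<open>card R\<close>.\<close>
    also have "\<dots> \<le> (\<Sum>k<N. \<tau> * s k + (if \<tau> < \<mu> k then \<mu> k else 0))"
    proof (rule sum_mono)
      fix k assume "k \<in> {..<N}"
      then have "\<mu> k * s k \<le> \<mu> k" using s[of k] \<sigma>(2)[of k] by (simp add: mult_left_le)
      moreover have "0 \<le> \<tau> * s k" using s(1) \<tau>(1) by simp
      moreover have "\<mu> k * s k \<le> \<tau> * s k" if "\<not> \<tau> < \<mu> k" using that s(1) by (intro mult_right_mono) auto
      ultimately show "\<mu> k * s k \<le> \<tau> * s k + (if \<tau> < \<mu> k then \<mu> k else 0)" by auto
    qed
    also have "\<dots> = \<tau> * real (card R) + (\<Sum>k | k < N \<and> \<tau> < \<mu> k. \<mu> k)"
      unfolding sum.distrib ssum[symmetric] sum_distrib_left[symmetric]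
      by (simp add: sum.If_cases lessThan_def Int_def)
    also have "\<dots> \<le> \<tau> * (real M * K) + \<epsilon>0"
      using \<tau> cardL R(3) by (intro add_mono mult_left_mono) linarith+
    finally show ?thesis by (simp add: mult_ac)
  qed
  moreover have "(\<Sum>a\<in>S. qform N \<sigma> (f a)) \<le> \<epsilon>1" using S(2) fS by simp
  ultimately have sig: "(\<Sum>a\<in>S \<union> R. qform N \<sigma> (f a)) \<le> \<epsilon>1 + real M * K * \<tau> + \<epsilon>0"
    using sum.union_disjoint[OF finS R(1,2), of "\<lambda>a. qform N \<sigma> (f a)"] by linarith
  have "(\<Sum>a\<in>S \<union> R. \<Sum>m=1..M. qform N (\<rho> m) (f a)) = (\<Sum>m=1..M. \<Sum>a\<in>S \<union> R. qform N (\<rho> m) (f a))"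
    by (rule sum.swap)
  also have "\<dots> \<ge> (\<Sum>m=1..M. 1 - \<epsilon>)" using code by (intro sum_mono)
  finally have "real M * (1 - \<epsilon>) \<le> (\<Sum>a\<in>S \<union> R. \<Sum>m=1..M. qform N (\<rho> m) (f a))" by simp
  then have "1 - \<epsilon> \<le> (\<Sum>a\<in>S \<union> R. \<Sum>m=1..M. qform N (\<rho> m) (f a)) / real M"
    using M by (simp add: field_simps)
  also have "\<dots> = (\<Sum>a\<in>S \<union> R. qform N \<Delta> (f a)) + (\<Sum>a\<in>S \<union> R. qform N \<sigma> (f a))"
    unfolding \<Delta>(3) sum_subtractf sum_divide_distrib by simp
  also have "\<dots> \<le> trace_norm N \<Delta> / 2 + (\<epsilon>1 + real M * K * \<tau> + \<epsilon>0)"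
    by (intro add_mono trace_norm_ge_test[OF \<Delta>(1,2) fin on] sig)
  finally show ?thesis by linarith
qed

section \<open>Entropy and linear programming duality\<close>

text \<open>Farkas's lemma by separation. If no \<open>v\<close> works, the subspace
  \<open>V\<close> misses the orthant above \<open>h - c\<close>; a separating functional vanishes
  on \<open>V\<close>, has nonnegative coefficients and, once normalised, is a distribution
  violating \<open>orth\<close>. The separation is weak, hence the strict inequality in
  \<open>orth\<close>.\<close>

lemma lagrange_multiplier:
  fixes h :: "'x::finite \<Rightarrow> real" and V :: "('x \<Rightarrow> real) set"
  assumes V0: "(\<lambda>_. 0) \<in> V" and V_add: "\<And>u v. u \<in> V \<Longrightarrow> v \<in> V \<Longrightarrow> (\<lambda>x. u x + v x) \<in> V"
    and V_scale: "\<And>t v. v \<in> V \<Longrightarrow> (\<lambda>x. t * v x) \<in> V"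
    and orth: "\<And>q. prob_dist q \<Longrightarrow> (\<And>v. v \<in> V \<Longrightarrow> (\<Sum>x\<in>UNIV. q x * v x) = 0) \<Longrightarrow> (\<Sum>x\<in>UNIV. q x * h x) < c"
  shows "\<exists>v\<in>V. \<forall>x. h x \<le> c + v x"
proof (rule ccontr)
  assume neg: "\<not> ?thesis"
  define S :: "(real, 'x) Finite_Cartesian_Product.vec set" where "S = vec_lambda ` V"
  define T :: "(real, 'x) Finite_Cartesian_Product.vec set" where "T = {y. \<forall>x. h x - c \<le> vec_nth y x}"
  have "convex S"
    unfolding convex_def
  proof (intro ballI allI impI)
    fix y z :: "(real, 'x) Finite_Cartesian_Product.vec" and u v :: real
    assume "y \<in> S" "z \<in> S"
    then obtain y' z' where yz: "y = vec_lambda y'" "z = vec_lambda z'" "y' \<in> V" "z' \<in> V" unfolding S_def by blast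
    have "u *\<^sub>R y + v *\<^sub>R z = vec_lambda (\<lambda>x. u * y' x + v * z' x)"
      unfolding yz by (simp add: Finite_Cartesian_Product.vec_eq_iff)
    then show "u *\<^sub>R y + v *\<^sub>R z \<in> S" unfolding S_def using V_add[OF V_scale V_scale] yz by blast
  qed
  moreover have "convex T"
    unfolding convex_def
  proof (intro ballI allI impI)
    fix y z :: "(real, 'x) Finite_Cartesian_Product.vec" and u v :: real
    assume yz: "y \<in> T" "z \<in> T" and uv: "0 \<le> u" "0 \<le> v" "u + v = 1"
    have "h x - c \<le> u * vec_nth y x + v * vec_nth z x" for x
    proof -
      have "h x - c = u * (h x - c) + v * (h x - c)" using uv(3) by (simp flip: distrib_right)
      also have "\<dots> \<le> u * vec_nth y x + v * vec_nth z x"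
        using yz uv unfolding T_def by (intro add_mono mult_left_mono) auto
      finally show ?thesis .
    qed
    then show "u *\<^sub>R y + v *\<^sub>R z \<in> T" unfolding T_def by simp
  qed
  moreover have "S \<noteq> {}" using V0 unfolding S_def by blast
  moreover have "T \<noteq> {}"
    unfolding T_def by (auto intro!: exI[of _ "vec_lambda (\<lambda>x. h x - c)"])
  moreover have "S \<inter> T = {}"
  proof -
    have "vec_lambda v \<notin> T" if "v \<in> V" for v
    proof
      assume "vec_lambda v \<in> T"
      then have "h x - c \<le> v x" for x unfolding T_def by simp
      then have "\<forall>x. h x \<le> c + v x" by (simp add: algebra_simps)
      then show False using neg that by blast
    qed
    then show ?thesis unfolding S_def by blast
  qed
  ultimately obtain a b where a: "a \<noteq> 0" and aS: "\<forall>y\<in>S. inner a y \<le> b" and aT: "\<forall>y\<in>T. b \<le> inner a y"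
    using separating_hyperplane_sets[of S T] by auto
  have inner: "inner a (vec_lambda y) = (\<Sum>x\<in>UNIV. vec_nth a x * y x)" for y
    by (simp add: inner_vec_def)
  have bV: "(\<Sum>x\<in>UNIV. vec_nth a x * v x) \<le> b" if "v \<in> V" for v
    using aS that unfolding S_def inner[symmetric] by blast
  have b0: "0 \<le> b" using bV[OF V0] by simp
  \<comment> \<open>A linear functional bounded above on a subspace vanishes there: otherwise some
    multiple of \<open>v\<close> would attain \<open>b + 1\<close>.\<close>
  have aV: "(\<Sum>x\<in>UNIV. vec_nth a x * v x) = 0" if "v \<in> V" for v
  proof (rule ccontr)
    let ?s = "\<Sum>x\<in>UNIV. vec_nth a x * v x"
    assume s: "?s \<noteq> 0"
    have "(\<Sum>x\<in>UNIV. vec_nth a x * (t * v x)) = t * ?s" for t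
      by (simp only: sum_distrib_left mult_ac)
    from this[of "(b + 1) / ?s"] have "(\<Sum>x\<in>UNIV. vec_nth a x * ((b + 1) / ?s * v x)) = b + 1"
      using s by simp
    then show False using bV[OF V_scale[OF that, of "(b + 1) / ?s"]] s by simp
  qed
  have bT: "0 \<le> (\<Sum>x\<in>UNIV. vec_nth a x * y x)" if "\<And>x. h x - c \<le> y x" for y
  proof -
    have "vec_lambda y \<in> T" unfolding T_def using that by simp
    then have "b \<le> inner a (vec_lambda y)" using aT by blast
    then show ?thesis using b0 unfolding inner by linarith
  qed
  \<comment> \<open>The orthant is unbounded upwards in each coordinate. With a negative coefficient
    at \<open>x\<close>, raising that coordinate by \<open>t\<close> would change the functional by
    \<open>- (\<bar>s\<bar> + 1)\<close> and make it negative.\<close>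
  have apos: "0 \<le> vec_nth a x" for x
  proof (rule ccontr)
    assume n: "\<not> 0 \<le> vec_nth a x"
    define s where "s = (\<Sum>x\<in>UNIV. vec_nth a x * (h x - c))"
    define t where "t = (\<bar>s\<bar> + 1) / (- vec_nth a x)"
    have t: "0 \<le> t" "vec_nth a x * t = - (\<bar>s\<bar> + 1)" unfolding t_def using n by (auto simp: field_simps)
    have "0 \<le> (\<Sum>z\<in>UNIV. vec_nth a z * (h z - c + (if z = x then t else 0)))"
      by (rule bT) (use t in auto)
    also have "\<dots> = s + (\<Sum>z\<in>UNIV. if z = x then vec_nth a z * t else 0)"
      unfolding s_def sum.distrib[symmetric] by (intro sum.cong refl) (simp add: distrib_left)
    also have "\<dots> = s - (\<bar>s\<bar> + 1)" using t by simp
    finally show False by linarith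
  qed
  define A where "A = (\<Sum>x\<in>UNIV. vec_nth a x)"
  have "\<exists>x. vec_nth a x \<noteq> 0" using a by (metis Finite_Cartesian_Product.vec_eq_iff zero_index)
  then have A: "0 < A" unfolding A_def using apos by (metis UNIV_I finite less_eq_real_def sum_pos2)
  define q where "q = (\<lambda>x. vec_nth a x / A)"
  have q: "(\<Sum>x\<in>UNIV. q x * y x) = (\<Sum>x\<in>UNIV. vec_nth a x * y x) / A" for y
    unfolding q_def by (simp add: sum_divide_distrib)
  have "prob_dist q"
    using q[of "\<lambda>_. 1"] A apos unfolding prob_dist_def q_def A_def by simp
  moreover have "(\<Sum>x\<in>UNIV. q x * v x) = 0" if "v \<in> V" for v using aV[OF that] q[of v] by simp
  ultimately have lt: "(\<Sum>x\<in>UNIV. q x * h x) < c" by (rule orth)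
  have "0 \<le> (\<Sum>x\<in>UNIV. q x * (h x - c))" unfolding q using bT[of "\<lambda>x. h x - c"] A by simp
  also have "\<dots> = (\<Sum>x\<in>UNIV. q x * h x) - c"
    using \<open>prob_dist q\<close> unfolding prob_dist_def by (simp add: right_diff_distrib sum_subtractf flip: sum_distrib_right)
  finally show False using lt by simp
qed

section \<open>Density matrices, entropy and mutual information\<close>

lemma density_qform_nonneg:
  assumes "density_mat d \<rho>"
  shows "0 \<le> qform d \<rho> v"
proof -
  have \<rho>: "\<rho> \<in> carrier_mat d d" using assms unfolding density_mat_def hermitian_mat_def by simp
  have "conjugate (Matrix.vec d v) \<bullet> (\<rho> *\<^sub>v Matrix.vec d v) = (\<Sum>i<d. \<Sum>j<d. cnj (v i) * \<rho> $$ (i, j) * v j)"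
    using \<rho> by (auto simp: scalar_prod_def lessThan_atLeast0 sum_distrib_left mult.assoc intro!: sum.cong)
  moreover have "0 \<le> Re (conjugate (Matrix.vec d v) \<bullet> (\<rho> *\<^sub>v Matrix.vec d v))"
    using assms unfolding density_mat_def by simp
  ultimately show ?thesis unfolding qform_def by simp
qed

lemma density_spectral:
  assumes "density_mat d \<rho>" "spectral_decomp d \<rho> U l"
  shows "k < d \<Longrightarrow> 0 \<le> l k" "(\<Sum>k<d. l k) = 1"
  using density_qform_nonneg[OF assms(1), of "mcol U k"] qform_mcol[OF assms(2), of k]
    mtrace_spectral[OF assms(2)] assms(1) unfolding density_mat_def by auto

lemma density_hermitian: "density_mat d \<rho> \<Longrightarrow> hermitian_mat d \<rho>"
  unfolding density_mat_def by simp

lemma density_carrier: "density_mat d \<rho> \<Longrightarrow> \<rho> \<in> carrier_mat d d"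
  unfolding density_mat_def hermitian_mat_def by simp

definition entropy :: "nat \<Rightarrow> complex mat \<Rightarrow> real" where
  "entropy d \<rho> = - Re (mtrace (\<rho> * mat_fun d lg \<rho>))"

text \<open>The state and its logarithm share the decomposition supplied by
  \<open>mat_fun_spectral\<close>, so the entropy is expressed in eigenvalues that come with an
  explicit eigenbasis.\<close>

lemma entropy_spectral:
  assumes "density_mat d \<rho>"
  shows "\<exists>U l. spectral_decomp d \<rho> U l \<and> entropy d \<rho> = (\<Sum>k<d. l k * - lg (l k))"
proof -
  obtain U l where U: "spectral_decomp d \<rho> U l" "spectral_decomp d (mat_fun d lg \<rho>) U (lg \<circ> l)"
    using mat_fun_spectral[OF density_hermitian[OF assms]] by blast
  have "entropy d \<rho> = (\<Sum>k<d. l k * - lg (l k))"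
    unfolding entropy_def mtrace_mult_spectral[OF U(2) density_carrier[OF assms]] sum_negf[symmetric]
    by (intro sum.cong refl) (simp add: qform_mcol[OF U(1)])
  then show ?thesis using U(1) by blast
qed

lemma avg_state_carrier: "avg_state d W q \<in> carrier_mat d d"
  unfolding avg_state_def by simp

lemma avg_state_index:
  "i < d \<Longrightarrow> j < d \<Longrightarrow> avg_state d W q $$ (i, j) = (\<Sum>x\<in>UNIV. of_real (q x) * W x $$ (i, j))"
  unfolding avg_state_def by simp

lemma qform_avg_state: "qform d (avg_state d W q) v = (\<Sum>x\<in>UNIV. q x * qform d (W x) v)"
  by (rule qform_lincomb[OF avg_state_index])

lemma avg_state_hermitian:
  "(\<And>x. density_mat d (W x)) \<Longrightarrow> hermitian_mat d (avg_state d W q)"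
  by (rule hermitian_lincomb[OF avg_state_carrier density_hermitian avg_state_index])

lemma avg_state_density:
  assumes "\<And>x. density_mat d (W x)" "prob_dist q"
  shows "density_mat d (avg_state d W q)"
proof -
  let ?\<sigma> = "avg_state d W q"
  have sp: "conjugate v \<bullet> (?\<sigma> *\<^sub>v v) = (\<Sum>i<d. \<Sum>j<d. cnj (v $ i) * ?\<sigma> $$ (i, j) * v $ j)"
    if "v \<in> carrier_vec d" for v :: "complex Matrix.vec"
    using avg_state_carrier[of d W q] that
    by (auto simp: scalar_prod_def lessThan_atLeast0 sum_distrib_left mult.assoc intro!: sum.cong)
  have nn: "0 \<le> qform d ?\<sigma> v" for v
    unfolding qform_avg_state using density_qform_nonneg[OF assms(1)] assms(2)
    unfolding prob_dist_def by (intro sum_nonneg mult_nonneg_nonneg) auto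
  have "0 \<le> Re (conjugate v \<bullet> (?\<sigma> *\<^sub>v v))" if "v \<in> carrier_vec d" for v
    using nn[of "\<lambda>i. v $ i"] unfolding sp[OF that] qform_def .
  moreover have "mtrace ?\<sigma> = 1"
  proof -
    have "mtrace ?\<sigma> = (\<Sum>x\<in>UNIV. of_real (q x) * mtrace (W x))"
      by (rule mtrace_lincomb[OF avg_state_carrier density_carrier[OF assms(1)] avg_state_index])
    also have "\<dots> = of_real (\<Sum>x\<in>UNIV. q x)" using assms(1) unfolding density_mat_def by simp
    finally show ?thesis using assms(2) unfolding prob_dist_def by simp
  qed
  ultimately show ?thesis using avg_state_hermitian[of d W q, OF assms(1)] unfolding density_mat_def by blast
qed

text \<open>Linearity holds for weights \<open>q\<close> of any sign; one application takes the
  difference of two distributions.\<close>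

lemma mtrace_avg_state_mult:
  assumes "\<And>x. density_mat d (W x)" "hermitian_mat d A"
  shows "Re (mtrace (avg_state d W q * A)) = (\<Sum>x\<in>UNIV. q x * Re (mtrace (W x * A)))"
proof -
  obtain G \<alpha> where G: "spectral_decomp d A G \<alpha>" using hermitian_spectral_decomp[OF assms(2)] by blast
  have "Re (mtrace (avg_state d W q * A)) = (\<Sum>k<d. \<Sum>x\<in>UNIV. q x * (\<alpha> k * qform d (W x) (mcol G k)))"
    unfolding mtrace_mult_spectral[OF G avg_state_carrier] qform_avg_state
    by (simp add: sum_distrib_left mult_ac)
  also have "\<dots> = (\<Sum>x\<in>UNIV. \<Sum>k<d. q x * (\<alpha> k * qform d (W x) (mcol G k)))" by (rule sum.swap)
  also have "\<dots> = (\<Sum>x\<in>UNIV. q x * Re (mtrace (W x * A)))"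
    by (simp add: mtrace_mult_spectral[OF G density_carrier[OF assms(1)]] sum_distrib_left)
  finally show ?thesis .
qed

lemma mat_fun_hermitian: "hermitian_mat d A \<Longrightarrow> hermitian_mat d (mat_fun d f A)"
  using mat_fun_spectral[of d A f] hermitian_spectral_decomp_conv by metis

text \<open>The logarithm of the average state is the same for all \<open>x\<close>, so the terms
  that contain it average to minus the entropy of that state. This leaves the Holevo form.\<close>

lemma mutual_info_entropy:
  assumes "\<And>x. density_mat d (W x)" "prob_dist q"
  shows "mutual_info d W q = entropy d (avg_state d W q) - (\<Sum>x\<in>UNIV. q x * entropy d (W x))"
proof -
  let ?\<sigma> = "avg_state d W q"
  have Y: "hermitian_mat d (mat_fun d lg ?\<sigma>)"
    by (intro mat_fun_hermitian avg_state_hermitian assms)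
  have "rel_entropy d (W x) ?\<sigma> = - entropy d (W x) - Re (mtrace (W x * mat_fun d lg ?\<sigma>))" for x
  proof -
    have X: "mat_fun d lg (W x) \<in> carrier_mat d d" and Y': "mat_fun d lg ?\<sigma> \<in> carrier_mat d d"
      using Y mat_fun_hermitian[OF density_hermitian[OF assms(1)]] unfolding hermitian_mat_def by auto
    have "mtrace (W x * (mat_fun d lg (W x) - mat_fun d lg ?\<sigma>))
        = (\<Sum>b\<in>UNIV. of_real (if b then 1 else -1) * mtrace (W x * (if b then mat_fun d lg (W x) else mat_fun d lg ?\<sigma>)))"
      by (rule mtrace_mult_lincomb[OF density_carrier[OF assms(1)]]) (use X Y' in \<open>auto simp: UNIV_bool\<close>)
    then show ?thesis unfolding rel_entropy_def entropy_def by (simp add: UNIV_bool)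
  qed
  then show ?thesis
    unfolding mutual_info_def
    by (simp add: right_diff_distrib sum_subtractf sum_negf entropy_def[of d ?\<sigma>] mtrace_avg_state_mult[OF assms(1) Y])
qed

text \<open>The trace of the square is the sum of the squared eigenvalues.\<close>

lemma hermitian_zero_of_trace_square:
  assumes "hermitian_mat d D" "Re (mtrace (D * D)) = 0" "i < d" "j < d"
  shows "D $$ (i, j) = 0"
proof -
  obtain U l where U: "spectral_decomp d D U l" using hermitian_spectral_decomp[OF assms(1)] by blast
  have "(\<Sum>k<d. (l k)\<^sup>2) = 0" using mtrace_spectral[OF spectral_decomp_square[OF U]] assms(2) by simp
  then have "\<And>k. k < d \<Longrightarrow> l k = 0" by (subst (asm) sum_nonneg_eq_0_iff) auto
  then show ?thesis unfolding spectral_decomp_index[OF U assms(3,4)] by simp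
qed

text \<open>Optimality of \<open>p\<close> bounds the mean output entropy over all \<open>q\<close>
  with the same average state. Dualising the constraint on the average state yields \<open>A\<close>
  as multiplier; \<open>\<delta>\<close> provides the strict inequality that
  \<open>lagrange_multiplier\<close> demands.\<close>

lemma entropy_lagrange_multiplier:
  fixes W :: "'x::finite \<Rightarrow> complex mat"
  assumes W: "\<And>x. density_mat d (W x)" and p: "prob_dist p"
    and opt: "\<And>q. prob_dist q \<Longrightarrow> avg_state d W q = avg_state d W p \<Longrightarrow> mutual_info d W p \<le> mutual_info d W q"
    and \<delta>: "0 < \<delta>"
  shows "\<exists>A. hermitian_mat d A \<and> (\<forall>x. entropy d (W x)
    \<le> entropy d (avg_state d W p) - mutual_info d W p + \<delta>
      + (Re (mtrace (W x * A)) - Re (mtrace (avg_state d W p * A))))"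
proof -
  let ?\<sigma> = "avg_state d W p"
  define c where "c = entropy d ?\<sigma> - mutual_info d W p + \<delta>"
  define L where "L = (\<lambda>A x. Re (mtrace (W x * A)) - Re (mtrace (?\<sigma> * A)))"
  \<comment> \<open>Combinations with two coefficients give zero, sums and multiples at
    once.\<close>
  have comb: "(\<lambda>x. s * L A x + t * L B x) \<in> L ` Collect (hermitian_mat d)"
    if AB: "hermitian_mat d A" "hermitian_mat d B" for A B and s t :: real
  proof -
    define C where "C = mat d d (\<lambda>ij. of_real s * A $$ ij + of_real t * B $$ ij)"
    have C: "C \<in> carrier_mat d d" unfolding C_def by simp
    have idx: "C $$ (i, j) = (\<Sum>b\<in>UNIV. of_real (if b then s else t) * (if b then A else B) $$ (i, j))"
      if "i < d" "j < d" for i j using that unfolding C_def by (simp add: UNIV_bool)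
    have carr: "(if b then A else B) \<in> carrier_mat d d" for b using AB unfolding hermitian_mat_def by simp
    have "hermitian_mat d C" by (rule hermitian_lincomb[OF C _ idx]) (use AB in auto)
    moreover have "mtrace (R * C) = of_real s * mtrace (R * A) + of_real t * mtrace (R * B)"
      if "R \<in> carrier_mat d d" for R
      using mtrace_mult_lincomb[OF that C carr idx] by (simp add: UNIV_bool)
    from this[OF density_carrier[OF W]] this[OF avg_state_carrier[of d W p]] have "L C = (\<lambda>x. s * L A x + t * L B x)"
      unfolding L_def by (simp add: algebra_simps)
    ultimately show ?thesis by (metis (mono_tags) image_eqI mem_Collect_eq)
  qed
  have "\<exists>v\<in>L ` Collect (hermitian_mat d). \<forall>x. entropy d (W x) \<le> c + v x"
  proof (rule lagrange_multiplier)
    have H: "hermitian_mat d ?\<sigma>" by (rule avg_state_hermitian[OF W])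
    show "(\<lambda>_. 0) \<in> L ` Collect (hermitian_mat d)"
      using comb[OF H H, of 0 0] by simp
    show "(\<lambda>x. u x + v x) \<in> L ` Collect (hermitian_mat d)"
      if uv: "u \<in> L ` Collect (hermitian_mat d)" "v \<in> L ` Collect (hermitian_mat d)" for u v
    proof -
      obtain A B where "hermitian_mat d A" "hermitian_mat d B" "u = L A" "v = L B" using uv by auto
      then show ?thesis using comb[of A B 1 1] by simp
    qed
    show "(\<lambda>x. t * v x) \<in> L ` Collect (hermitian_mat d)" if v: "v \<in> L ` Collect (hermitian_mat d)" for t v
    proof -
      obtain A where "hermitian_mat d A" "v = L A" using v by auto
      then show ?thesis using comb[of A A t 0] by simp
    qed
    fix q :: "'x \<Rightarrow> real"
    assume q: "prob_dist q" and orth: "\<And>v. v \<in> L ` Collect (hermitian_mat d) \<Longrightarrow> (\<Sum>x\<in>UNIV. q x * v x) = 0"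
    have eq: "Re (mtrace (avg_state d W q * A)) = Re (mtrace (?\<sigma> * A))" if A: "hermitian_mat d A" for A
    proof -
      have "(\<Sum>x\<in>UNIV. q x * L A x) = 0" using orth A by blast
      then show ?thesis
        unfolding L_def mtrace_avg_state_mult[of d W A q, OF W A] using q
        by (simp add: right_diff_distrib sum_subtractf prob_dist_def flip: sum_distrib_right)
    qed
    \<comment> \<open>The two average states have equal traces against every Hermitian matrix.
      Testing with their own difference shows that it vanishes.\<close>
    define D where "D = avg_state d W q - ?\<sigma>"
    have D: "D \<in> carrier_mat d d" unfolding D_def by (intro minus_carrier_mat avg_state_carrier)
    have idx: "D $$ (i, j) = (\<Sum>x\<in>UNIV. of_real (q x - p x) * W x $$ (i, j))" if "i < d" "j < d" for i j
      using that carrier_matD[OF avg_state_carrier[of d W p]] unfolding D_def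
      by (simp add: avg_state_index sum_subtractf left_diff_distrib)
    have hD: "hermitian_mat d D" by (rule hermitian_lincomb[OF D density_hermitian[OF W] idx])
    have "D = avg_state d W (\<lambda>x. q x - p x)"
      by (rule eq_matI) (use D idx in \<open>auto simp: avg_state_def\<close>)
    then have "Re (mtrace (D * D)) = Re (mtrace (avg_state d W (\<lambda>x. q x - p x) * D))" by simp
    also have "\<dots> = Re (mtrace (avg_state d W q * D)) - Re (mtrace (?\<sigma> * D))"
      unfolding mtrace_avg_state_mult[OF W hD] by (simp add: left_diff_distrib sum_subtractf)
    finally have "Re (mtrace (D * D)) = 0" using eq[OF hD] by simp
    from hermitian_zero_of_trace_square[OF hD this] have "avg_state d W q = ?\<sigma>"
      using carrier_matD[OF avg_state_carrier[of d W p]] carrier_matD[OF avg_state_carrier[of d W q]]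
      unfolding D_def by (intro eq_matI) auto
    from opt[OF q this] show "(\<Sum>x\<in>UNIV. q x * entropy d (W x)) < c"
      unfolding mutual_info_entropy[OF W q] \<open>avg_state d W q = ?\<sigma>\<close> c_def using \<delta> by linarith
  qed
  then show ?thesis unfolding L_def c_def by auto
qed

text \<open>The probability of a word is governed by its total self-information. Positivity excludes
  letters of probability 0, at which \<open>lg\<close> takes the default value 0.\<close>

lemma word_prod_eq_powr:
  assumes "\<And>x b. b < d \<Longrightarrow> 0 \<le> w x b" "j < d ^ n" "0 < word_prod d w n c j"
  shows "word_prod d w n c j = 2 powr (- word_sum d (\<lambda>x b. - lg (w x b)) n c j)"
  using assms(2,3)
proof (induction n arbitrary: j)
  case (Suc n)
  then have j: "j < d ^ n * d" by (simp add: mult.commute)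
  have "0 \<le> word_prod d w n c (j div d)" by (rule word_prod_nonneg[OF assms(1) div_mod_less(1)[OF j]])
  moreover have "0 \<le> w (c n) (j mod d)" by (rule assms(1)[OF div_mod_less(2)[OF j]])
  ultimately have pos: "0 < word_prod d w n c (j div d)" "0 < w (c n) (j mod d)"
    using Suc.prems(2) by (auto simp: zero_less_mult_iff)
  have "2 powr lg (w (c n) (j mod d)) = w (c n) (j mod d)" using pos(2) unfolding lg_def by simp
  then show ?case
    using Suc.IH[OF div_mod_less(1)[OF j] pos(1)] by (simp add: powr_diff powr_minus_divide)
qed simp

text \<open>A statistic that ignores the codeword letter is the same function on words for all
  codewords; thus a single index set \<open>S\<close> can serve the whole codebook.\<close>

lemma word_sum_letter_indep: "word_sum d (\<lambda>_. t) n c k = word_sum d (\<lambda>_. t) n c' k"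
  by (induction n arbitrary: k) auto

section \<open>The finite blocklength bound\<close>

lemma tensor_word_density:
  assumes "\<And>x. density_mat d (W x)"
  shows "hermitian_mat (d ^ n) (tensor_word W n c)"
    and "Re (mtrace (tensor_word W n c)) = 1"
    and "0 \<le> qform (d ^ n) (tensor_word W n c) v"
proof -
  have "\<forall>x. \<exists>U l. spectral_decomp d (W x) U l"
    using hermitian_spectral_decomp[OF density_hermitian[OF assms]] by blast
  then obtain U l where U: "\<And>x. spectral_decomp d (W x) (U x) (l x)" by metis
  note spec = tensor_word_spectral[of d W U l n c, OF U]
  note l = density_spectral[OF assms U]
  show "hermitian_mat (d ^ n) (tensor_word W n c)" by (rule hermitian_spectral_decomp_conv[OF spec])
  show "Re (mtrace (tensor_word W n c)) = 1"
    unfolding mtrace_spectral[OF spec] by (rule word_prod_sum[OF l(2)])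
  show "0 \<le> qform (d ^ n) (tensor_word W n c) v"
    unfolding qform_spectral[OF spec] using word_prod_nonneg[of d l, OF l(1)]
    by (intro sum_nonneg mult_nonneg_nonneg) auto
qed

lemma codebook_state_index:
  "i < d ^ n \<Longrightarrow> j < d ^ n \<Longrightarrow> codebook_state d W n M cw $$ (i, j)
    = (\<Sum>m\<in>{1..M}. of_real (1 / real M) * tensor_word W n (cw m) $$ (i, j))"
  unfolding codebook_state_def by (simp add: sum_divide_distrib)

lemma codebook_state_carrier: "codebook_state d W n M cw \<in> carrier_mat (d ^ n) (d ^ n)"
  unfolding codebook_state_def by simp

context
  fixes d :: nat and W :: "'x::finite \<Rightarrow> complex mat" and \<sigma> :: "complex mat"
  assumes W: "\<And>x. density_mat d (W x)" and \<sigma>: "density_mat d \<sigma>"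
begin

lemma codebook_state_density:
  assumes "1 \<le> M"
  shows "hermitian_mat (d ^ n) (codebook_state d W n M cw)"
    and "Re (mtrace (codebook_state d W n M cw)) = 1"
    and "qform (d ^ n) (codebook_state d W n M cw) v = (\<Sum>m=1..M. qform (d ^ n) (tensor_word W n (cw m)) v) / real M"
proof -
  note T = tensor_word_density[of d W, OF W]
  have carr: "tensor_word W n (cw m) \<in> carrier_mat (d ^ n) (d ^ n)" for m
    by (rule tensor_word_carrier[OF density_carrier[OF W]])
  show "hermitian_mat (d ^ n) (codebook_state d W n M cw)"
    by (rule hermitian_lincomb[OF codebook_state_carrier T(1) codebook_state_index])
  show "Re (mtrace (codebook_state d W n M cw)) = 1"
    using assms by (simp add: mtrace_lincomb[OF codebook_state_carrier carr codebook_state_index] T(2))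
  show "qform (d ^ n) (codebook_state d W n M cw) v = (\<Sum>m=1..M. qform (d ^ n) (tensor_word W n (cw m)) v) / real M"
    by (simp add: qform_lincomb[OF codebook_state_index] sum_divide_distrib)
qed

lemma tensor_power_density:
  "hermitian_mat (d ^ n) (tensor_power \<sigma> n)" "Re (mtrace (tensor_power \<sigma> n)) = 1"
  "0 \<le> qform (d ^ n) (tensor_power \<sigma> n) v"
  using tensor_word_density[of d "\<lambda>_::unit. \<sigma>" n "\<lambda>_. ()", OF \<sigma>] unfolding tensor_power_def by auto

lemma codebook_diff:
  fixes n M :: nat and cw :: "nat \<Rightarrow> nat \<Rightarrow> 'x"
  assumes "1 \<le> M"
  defines "\<Delta> \<equiv> codebook_state d W n M cw - tensor_power \<sigma> n"
  shows "hermitian_mat (d ^ n) \<Delta>" "Re (mtrace \<Delta>) = 0"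
    and "qform (d ^ n) \<Delta> v = qform (d ^ n) (codebook_state d W n M cw) v - qform (d ^ n) (tensor_power \<sigma> n) v"
proof -
  let ?R = "codebook_state d W n M cw" and ?S = "tensor_power \<sigma> n"
  \<comment> \<open>The difference is a combination indexed by \<open>bool\<close>, with
    coefficients 1 and -1.\<close>
  let ?c = "\<lambda>b::bool. if b then 1 else -1 :: real" and ?B = "\<lambda>b::bool. if b then ?R else ?S"
  have S: "?S \<in> carrier_mat (d ^ n) (d ^ n)" using tensor_power_density(1) unfolding hermitian_mat_def by simp
  have \<Delta>: "\<Delta> \<in> carrier_mat (d ^ n) (d ^ n)" unfolding \<Delta>_def using S by (rule minus_carrier_mat)
  have idx: "\<Delta> $$ (i, j) = (\<Sum>b\<in>UNIV. of_real (?c b) * ?B b $$ (i, j))" if "i < d ^ n" "j < d ^ n" for i j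
    unfolding \<Delta>_def using S that by (simp add: UNIV_bool)
  have herm: "hermitian_mat (d ^ n) (?B b)" for b
    using codebook_state_density(1)[OF assms(1)] tensor_power_density(1) by simp
  have carr: "?B b \<in> carrier_mat (d ^ n) (d ^ n)" for b using herm[of b] unfolding hermitian_mat_def by blast
  show "hermitian_mat (d ^ n) \<Delta>" by (rule hermitian_lincomb[OF \<Delta> herm idx])
  have "mtrace \<Delta> = (\<Sum>b\<in>UNIV. of_real (?c b) * mtrace (?B b))"
    by (rule mtrace_lincomb[OF \<Delta> carr idx])
  then show "Re (mtrace \<Delta>) = 0"
    by (simp add: UNIV_bool codebook_state_density(2)[OF assms(1)] tensor_power_density(2))
  have "qform (d ^ n) \<Delta> v = (\<Sum>b\<in>UNIV. ?c b * qform (d ^ n) (?B b) v)"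
    by (rule qform_lincomb[OF idx])
  then show "qform (d ^ n) \<Delta> v = qform (d ^ n) ?R v - qform (d ^ n) ?S v"
    by (simp add: UNIV_bool)
qed

lemma codebook_trace_distance_le:
  assumes "1 \<le> M"
  shows "trace_norm (d ^ n) (codebook_state d W n M cw - tensor_power \<sigma> n) / 2 \<le> 1"
proof -
  have "0 \<le> qform (d ^ n) (codebook_state d W n M cw) v" for v
    unfolding codebook_state_density(3)[OF assms]
    by (intro divide_nonneg_nonneg sum_nonneg tensor_word_density(3)[of d W, OF W]) auto
  moreover have "tensor_power \<sigma> n \<in> carrier_mat (d ^ n) (d ^ n)"
    using tensor_power_density(1) unfolding hermitian_mat_def by simp
  ultimately have "trace_norm (d ^ n) (codebook_state d W n M cw - tensor_power \<sigma> n)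
      \<le> Re (mtrace (codebook_state d W n M cw)) + Re (mtrace (tensor_power \<sigma> n))"
    by (intro trace_norm_diff_le codebook_diff codebook_state_carrier tensor_power_density assms)
  then show ?thesis
    by (simp add: codebook_state_density(2)[OF assms] tensor_power_density(2))
qed

text \<open>Here \<open>\<sigma>\<close> is any density matrix, tied to \<open>W\<close> only
  through \<open>lag\<close>. The constant \<open>K\<close> is built from single-letter variances
  and so is uniform in the blocklength and the codebook.\<close>

lemma finite_blocklength_bound:
  assumes A: "hermitian_mat d A" and \<delta>: "0 < \<delta>"
    and lag: "\<And>x. entropy d (W x) \<le> c + (Re (mtrace (W x * A)) - Re (mtrace (\<sigma> * A)))"
  shows "\<exists>K. \<forall>n M cw. 0 < n \<longrightarrow> 1 \<le> M \<longrightarrow>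
    1 - K / real n - real M * 2 powr (real n * (c + 2 * \<delta>)) * 2 powr (- (real n * (entropy d \<sigma> - \<delta>)))
    \<le> trace_norm (d ^ n) (codebook_state d W n M cw - tensor_power \<sigma> n) / 2"
proof -
  have "\<forall>x. \<exists>U l. spectral_decomp d (W x) U l \<and> entropy d (W x) = (\<Sum>k<d. l k * - lg (l k))"
    using entropy_spectral[OF W] by blast
  then obtain U l where U: "\<And>x. spectral_decomp d (W x) (U x) (l x)"
    and hW: "\<And>x. entropy d (W x) = (\<Sum>k<d. l x k * - lg (l x k))" by metis
  obtain F \<mu> where F: "spectral_decomp d \<sigma> F \<mu>" and h\<sigma>: "entropy d \<sigma> = (\<Sum>k<d. \<mu> k * - lg (\<mu> k))"
    using entropy_spectral[OF \<sigma>] by blast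
  obtain G \<alpha> where G: "spectral_decomp d A G \<alpha>" using hermitian_spectral_decomp[OF A] by blast
  have Gu: "unitary_mat d G" and Gc: "G \<in> carrier_mat d d" using G unfolding spectral_decomp_def unitary_mat_def by auto
  note l = density_spectral[OF W U] and \<mu> = density_spectral[OF \<sigma> F]
  \<comment> \<open>\<open>w x\<close> and \<open>s\<close> are the outcome distributions of
    measuring \<open>A\<close> on \<open>W x\<close> and on \<open>\<sigma>\<close>.\<close>
  define w where "w = (\<lambda>x k. qform d (W x) (mcol G k))"
  define s where "s = (\<lambda>k. qform d \<sigma> (mcol G k))"
  define aW where "aW = (\<lambda>x. Re (mtrace (W x * A)))"
  define aS where "aS = Re (mtrace (\<sigma> * A))"
  have probe: "0 \<le> qform d \<rho> (mcol G k)" "(\<Sum>k<d. qform d \<rho> (mcol G k)) = 1"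
    "Re (mtrace (\<rho> * A)) = (\<Sum>k<d. qform d \<rho> (mcol G k) * \<alpha> k)" if \<rho>: "density_mat d \<rho>" for \<rho> k
  proof -
    show "0 \<le> qform d \<rho> (mcol G k)" by (rule density_qform_nonneg[OF \<rho>])
    show "(\<Sum>k<d. qform d \<rho> (mcol G k)) = 1"
      unfolding mtrace_eq_sum_qform[OF Gu density_carrier[OF \<rho>], symmetric]
      using \<rho> unfolding density_mat_def by simp
    show "Re (mtrace (\<rho> * A)) = (\<Sum>k<d. qform d \<rho> (mcol G k) * \<alpha> k)"
      unfolding mtrace_mult_spectral[OF G density_carrier[OF \<rho>]] by (simp only: mult.commute)
  qed
  have w: "0 \<le> w x k" "(\<Sum>k<d. w x k) = 1" "aW x = (\<Sum>k<d. w x k * \<alpha> k)" for x k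
    unfolding w_def aW_def by (rule probe[OF W])+
  have s: "0 \<le> s k" "(\<Sum>k<d. s k) = 1" "aS = (\<Sum>k<d. s k * \<alpha> k)" for k
    unfolding s_def aS_def by (rule probe[OF \<sigma>])+
  \<comment> \<open>One bound for four kinds of variance: of the self-information and of the
    measured value of \<open>A\<close>, each for the outputs \<open>W x\<close> and for
    \<open>\<sigma>\<close>.\<close>
  define V where "V = (\<Sum>x\<in>UNIV. \<Sum>b<d. l x b * (- lg (l x b) - entropy d (W x))\<^sup>2)
    + (\<Sum>x\<in>UNIV. \<Sum>b<d. w x b * (\<alpha> b - aW x)\<^sup>2)
    + (\<Sum>b<d. \<mu> b * (- lg (\<mu> b) - entropy d \<sigma>)\<^sup>2) + (\<Sum>b<d. s b * (\<alpha> b - aS)\<^sup>2)"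
  have nn: "0 \<le> (\<Sum>b<d. l x b * (- lg (l x b) - entropy d (W x))\<^sup>2)" "0 \<le> (\<Sum>b<d. w x b * (\<alpha> b - aW x)\<^sup>2)"
    "0 \<le> (\<Sum>b<d. \<mu> b * (- lg (\<mu> b) - entropy d \<sigma>)\<^sup>2)" "0 \<le> (\<Sum>b<d. s b * (\<alpha> b - aS)\<^sup>2)" for x
    using l(1) w(1) \<mu>(1) s(1) by (auto intro!: sum_nonneg)
  have V1: "(\<Sum>b<d. l x b * (- lg (l x b) - entropy d (W x))\<^sup>2) \<le> V" for x
    using member_le_sum[of x UNIV "\<lambda>x. \<Sum>b<d. l x b * (- lg (l x b) - entropy d (W x))\<^sup>2"]
      sum_nonneg[of UNIV "\<lambda>x. \<Sum>b<d. w x b * (\<alpha> b - aW x)\<^sup>2"] nn unfolding V_def by simp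
  have V2: "(\<Sum>b<d. w x b * (\<alpha> b - aW x)\<^sup>2) \<le> V" for x
    using member_le_sum[of x UNIV "\<lambda>x. \<Sum>b<d. w x b * (\<alpha> b - aW x)\<^sup>2"]
      sum_nonneg[of UNIV "\<lambda>x. \<Sum>b<d. l x b * (- lg (l x b) - entropy d (W x))\<^sup>2"] nn unfolding V_def by simp
  have V3: "(\<Sum>b<d. \<mu> b * (- lg (\<mu> b) - entropy d \<sigma>)\<^sup>2) \<le> V" and V4: "(\<Sum>b<d. s b * (\<alpha> b - aS)\<^sup>2) \<le> V"
    using sum_nonneg[of UNIV "\<lambda>x. \<Sum>b<d. w x b * (\<alpha> b - aW x)\<^sup>2"]
      sum_nonneg[of UNIV "\<lambda>x. \<Sum>b<d. l x b * (- lg (l x b) - entropy d (W x))\<^sup>2"] nn unfolding V_def by simp_all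
  have Vnn: "0 \<le> V" using V3 nn(3) by linarith
  have "1 - (12 * V / \<delta>\<^sup>2) / real n - real M * 2 powr (real n * (c + 2 * \<delta>)) * 2 powr (- (real n * (entropy d \<sigma> - \<delta>)))
    \<le> trace_norm (d ^ n) (codebook_state d W n M cw - tensor_power \<sigma> n) / 2"
    if n: "0 < n" and M: "1 \<le> M" for n M cw
  proof -
    define N where "N = d ^ n"
    \<comment> \<open>The Chebyshev bound for deviations of \<open>\<delta> / 2\<close> per letter;
      it also covers those of \<open>\<delta>\<close>.\<close>
    define \<epsilon> where "\<epsilon> = V / (real n * (\<delta> / 2)\<^sup>2)"
    have \<epsilon>1: "V / (real n * \<delta>\<^sup>2) \<le> \<epsilon>"
      unfolding \<epsilon>_def using n \<delta> Vnn by (intro divide_left_mono mult_left_mono power_mono mult_pos_pos) auto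
    define \<tau> where "\<tau> = 2 powr (- (real n * (entropy d \<sigma> - \<delta>)))"
    define B where "B = 2 powr (real n * (c + 2 * \<delta>))"
    \<comment> \<open>A dummy codeword: the laws and statistics attached to \<open>\<sigma>\<close>
      are the same for all letters.\<close>
    define c0 :: "nat \<Rightarrow> 'x" where "c0 = (\<lambda>_. undefined)"
    let ?\<mu> = "word_prod d (\<lambda>_. \<mu>) n c0"
    have T\<sigma>: "spectral_decomp N (tensor_power \<sigma> n) (tensor_power F n) ?\<mu>"
      using tensor_word_spectral[of d "\<lambda>_. \<sigma>" "\<lambda>_. F" "\<lambda>_. \<mu>" n c0, OF F] unfolding tensor_word_const N_def .
    have \<mu>nn: "0 \<le> ?\<mu> k" if "k < N" for k
      unfolding N_def by (rule word_prod_nonneg) (use \<mu>(1) that in \<open>auto simp: N_def\<close>)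
    \<comment> \<open>An eigenvalue above \<open>\<tau>\<close> has self-information more than
      \<open>real n * \<delta>\<close> below its mean
      \<open>real n * entropy d \<sigma>\<close>.\<close>
    have "(\<Sum>k | k < N \<and> \<tau> < ?\<mu> k. ?\<mu> k) \<le> V / (real n * \<delta>\<^sup>2)"
    proof (rule word_sum_chebyshev[where t = "\<lambda>_ b. - lg (\<mu> b)" and m = "\<lambda>_. entropy d \<sigma>"])
      fix j assume "j \<in> {k. k < N \<and> \<tau> < ?\<mu> k}"
      then have j: "j < d ^ n" "\<tau> < ?\<mu> j" unfolding N_def by auto
      moreover have "0 < \<tau>" unfolding \<tau>_def by simp
      ultimately have "\<tau> < 2 powr (- word_sum d (\<lambda>_ b. - lg (\<mu> b)) n c0 j)"
        using word_prod_eq_powr[of d "\<lambda>_. \<mu>" j n c0] \<mu>(1) by simp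
      then have "word_sum d (\<lambda>_ b. - lg (\<mu> b)) n c0 j < real n * (entropy d \<sigma> - \<delta>)"
        unfolding \<tau>_def by (simp add: powr_less_cancel_iff)
      then show "real n * \<delta> \<le> \<bar>word_sum d (\<lambda>_ b. - lg (\<mu> b)) n c0 j - (\<Sum>i<n. entropy d \<sigma>)\<bar>"
        by (simp add: algebra_simps)
    qed (use \<mu> h\<sigma> V3 n \<delta> N_def in auto)
    with \<epsilon>1 have typical: "(\<Sum>k | k < N \<and> \<tau> < ?\<mu> k. ?\<mu> k) \<le> \<epsilon>" by linarith
    have Gn: "unitary_mat N (tensor_power G n)"
      using tensor_word_unitary[of d "\<lambda>_. G" n c0, OF Gu] unfolding tensor_word_const N_def .
    \<comment> \<open>The threshold lies halfway between the mean \<open>real n * aS\<close> under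
      \<open>\<sigma>\<close> and the value \<open>real n * (aS + \<delta>)\<close>, which the mean
      exceeds for codewords of the first kind. Either error is a deviation of at least
      \<open>\<delta> / 2\<close> per letter.\<close>
    define S where "S = {k. k < N \<and> real n * (aS + \<delta> / 2) \<le> word_sum d (\<lambda>_. \<alpha>) n c0 k}"
    have S: "S \<subseteq> {..<N}" unfolding S_def by auto
    have qG: "qform N (tensor_word W n x) (mcol (tensor_power G n) k) = word_prod d w n x k" if "k < N" for k x
      using qform_tensor_word[of d W U l "\<lambda>_. G" k n x, OF U Gc] that unfolding tensor_word_const N_def w_def .
    have qS: "qform N (tensor_power \<sigma> n) (mcol (tensor_power G n) k) = word_prod d (\<lambda>_. s) n c0 k" if "k < N" for k
      using qform_tensor_word[of d "\<lambda>_. \<sigma>" "\<lambda>_. F" "\<lambda>_. \<mu>" "\<lambda>_. G" k n c0, OF F Gc] that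
      unfolding tensor_word_const N_def s_def .
    have "(\<Sum>k\<in>S. word_prod d (\<lambda>_. s) n c0 k) \<le> \<epsilon>"
      unfolding \<epsilon>_def
    proof (rule word_sum_chebyshev[where t = "\<lambda>_. \<alpha>" and m = "\<lambda>_. aS"])
      fix j assume "j \<in> S"
      then have "real n * (aS + \<delta> / 2) \<le> word_sum d (\<lambda>_. \<alpha>) n c0 j" unfolding S_def by simp
      then show "real n * (\<delta> / 2) \<le> \<bar>word_sum d (\<lambda>_. \<alpha>) n c0 j - (\<Sum>i<n. aS)\<bar>"
        by (intro order_trans[OF _ abs_ge_self]) (simp add: algebra_simps)
    qed (use s V4 n \<delta> S N_def in auto)
    moreover have "(\<Sum>k\<in>S. qform N (tensor_power \<sigma> n) (mcol (tensor_power G n) k)) = (\<Sum>k\<in>S. word_prod d (\<lambda>_. s) n c0 k)"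
      using S qS by (intro sum.cong) auto
    ultimately have S\<epsilon>: "(\<Sum>k\<in>S. qform N (tensor_power \<sigma> n) (mcol (tensor_power G n) k)) \<le> \<epsilon>" by simp
    have lnn: "0 \<le> word_prod d l n x k" if "k < N" for k x
      unfolding N_def by (rule word_prod_nonneg) (use l(1) that in \<open>auto simp: N_def\<close>)
    have word: "1 - \<epsilon> \<le> (\<Sum>k\<in>S. qform N (tensor_word W n x) (mcol (tensor_power G n) k))
      \<or> (\<exists>J\<subseteq>{..<N}. real (card J) \<le> B \<and> 1 - \<epsilon> \<le> (\<Sum>j\<in>J. word_prod d l n x j))" for x
    proof (cases "(\<Sum>i<n. aW (x i) - aS) \<le> real n * \<delta>")
      case False
      have "(\<Sum>k\<in>{..<N} - S. word_prod d w n x k) \<le> \<epsilon>"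
        unfolding \<epsilon>_def
      proof (rule word_sum_chebyshev[where t = "\<lambda>_. \<alpha>" and m = aW])
        fix j assume "j \<in> {..<N} - S"
        then have "word_sum d (\<lambda>_. \<alpha>) n x j < real n * (aS + \<delta> / 2)"
          unfolding S_def using word_sum_letter_indep[of d \<alpha> n x j c0] by auto
        then show "real n * (\<delta> / 2) \<le> \<bar>word_sum d (\<lambda>_. \<alpha>) n x j - (\<Sum>i<n. aW (x i))\<bar>"
          using False by (intro order_trans[OF _ abs_ge_minus_self]) (simp add: algebra_simps sum_subtractf)
      qed (use w V2 n \<delta> N_def in auto)
      moreover have "(\<Sum>k<N. word_prod d w n x k) = 1" unfolding N_def by (rule word_prod_sum[OF w(2)])
      moreover have "(\<Sum>k<N. word_prod d w n x k) = (\<Sum>k\<in>{..<N} - S. word_prod d w n x k) + (\<Sum>k\<in>S. word_prod d w n x k)"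
        using S by (intro sum.subset_diff) auto
      moreover have "(\<Sum>k\<in>S. qform N (tensor_word W n x) (mcol (tensor_power G n) k)) = (\<Sum>k\<in>S. word_prod d w n x k)"
        using S qG by (intro sum.cong) auto
      ultimately show ?thesis by linarith
    next
      case True
      let ?s = "word_sum d (\<lambda>x b. - lg (l x b)) n x"
      \<comment> \<open>Null eigenvalues are excluded explicitly: since \<open>lg 0 = 0\<close>,
        their \<open>?s\<close> may be small although they have no bound from below.\<close>
      define J where "J = {j. j < N \<and> 0 < word_prod d l n x j \<and> ?s j \<le> real n * (c + 2 * \<delta>)}"
      define Z where "Z = {j. j < N \<and> real n * (c + 2 * \<delta>) < ?s j}"
      have J: "J \<subseteq> {..<N}" unfolding J_def by auto
      have one: "(\<Sum>k<N. word_prod d l n x k) = 1" unfolding N_def by (rule word_prod_sum[OF l(2)])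
      \<comment> \<open>Each member of \<open>J\<close> has probability at least
        \<open>1 / B\<close>, and the total probability is 1.\<close>
      have "real (card J) * (1 / B) = (\<Sum>j\<in>J. 1 / B)" by simp
      also have "\<dots> \<le> (\<Sum>j\<in>J. word_prod d l n x j)"
      proof (rule sum_mono)
        fix j assume "j \<in> J"
        then have j: "j < d ^ n" "0 < word_prod d l n x j" "?s j \<le> real n * (c + 2 * \<delta>)"
          unfolding J_def N_def by auto
        have "word_prod d l n x j = 2 powr (- ?s j)" by (rule word_prod_eq_powr[OF l(1) j(1,2)])
        also have "\<dots> \<ge> 2 powr (- (real n * (c + 2 * \<delta>)))" using j(3) by simp
        finally show "1 / B \<le> word_prod d l n x j" unfolding B_def by (simp add: powr_minus_divide)
      qed
      also have "\<dots> \<le> (\<Sum>k<N. word_prod d l n x k)" using J lnn by (intro sum_mono2) auto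
      finally have card: "real (card J) \<le> B" unfolding one B_def by (simp add: field_simps)
      have "(\<Sum>i<n. entropy d (W (x i))) \<le> (\<Sum>i<n. c + (aW (x i) - aS))"
        using lag unfolding aW_def aS_def by (intro sum_mono)
      also have "\<dots> = real n * c + (\<Sum>i<n. aW (x i) - aS)" by (simp add: sum.distrib)
      \<comment> \<open>The multiplier bound puts the mean self-information at most at
        \<open>real n * (c + \<delta>)\<close>, so membership in \<open>Z\<close> is a deviation of
        more than \<open>\<delta>\<close> per letter.\<close>
      finally have mean: "(\<Sum>i<n. entropy d (W (x i))) \<le> real n * c + real n * \<delta>" using True by linarith
      have "(\<Sum>k\<in>Z. word_prod d l n x k) \<le> V / (real n * \<delta>\<^sup>2)"
      proof (rule word_sum_chebyshev[where t = "\<lambda>x b. - lg (l x b)" and m = "\<lambda>x. entropy d (W x)"])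
        fix j assume "j \<in> Z"
        then have "real n * (c + 2 * \<delta>) < ?s j" unfolding Z_def by simp
        then show "real n * \<delta> \<le> \<bar>?s j - (\<Sum>i<n. entropy d (W (x i)))\<bar>"
          using mean by (simp add: algebra_simps)
      qed (use l hW V1 n \<delta> N_def Z_def in auto)
      \<comment> \<open>The complement of \<open>J\<close> exceeds \<open>Z\<close> only by null
        eigenvalues.\<close>
      moreover have "(\<Sum>k\<in>{..<N} - J. word_prod d l n x k) = (\<Sum>k\<in>Z. word_prod d l n x k)"
      proof (rule sum.mono_neutral_right)
        show "\<forall>i\<in>{..<N} - J - Z. word_prod d l n x i = 0"
          unfolding J_def Z_def using lnn[of _ x] by (auto simp: not_less le_less)
      qed (auto simp: J_def Z_def)
      moreover have "(\<Sum>k<N. word_prod d l n x k) = (\<Sum>k\<in>{..<N} - J. word_prod d l n x k) + (\<Sum>k\<in>J. word_prod d l n x k)"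
        using J by (intro sum.subset_diff) auto
      ultimately have "1 - \<epsilon> \<le> (\<Sum>j\<in>J. word_prod d l n x j)" using one \<epsilon>1 by linarith
      then show ?thesis using J card by blast
    qed
    have TW: "spectral_decomp N (tensor_word W n (cw m)) (tensor_word U n (cw m)) (word_prod d l n (cw m))" for m
      unfolding N_def by (rule tensor_word_spectral[OF U])
    have "1 - \<epsilon> - \<epsilon> - \<epsilon> - real M * B * \<tau> \<le> trace_norm N (codebook_state d W n M cw - tensor_power \<sigma> n) / 2"
    proof (rule resolvability_test[OF T\<sigma> \<mu>nn _ typical Gn S S\<epsilon> M _ TW lnn word])
      show "qform N (codebook_state d W n M cw - tensor_power \<sigma> n) v
          = (\<Sum>m=1..M. qform N (tensor_word W n (cw m)) v) / real M - qform N (tensor_power \<sigma> n) v" for v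
        using codebook_diff(3)[OF M] codebook_state_density(3)[OF M] unfolding N_def by simp
    qed (use codebook_diff(1,2)[OF M] in \<open>auto simp: N_def \<tau>_def B_def\<close>)
    \<comment> \<open>Three errors, each with a factor 4 from the square of
      \<open>\<delta> / 2\<close>.\<close>
    moreover have "\<epsilon> + \<epsilon> + \<epsilon> = (12 * V / \<delta>\<^sup>2) / real n"
      unfolding \<epsilon>_def using n \<delta> by (simp add: field_simps power2_eq_square)
    ultimately show ?thesis unfolding N_def B_def \<tau>_def by linarith
  qed
  then show ?thesis by blast
qed

end

section \<open>Passage to the limit\<close>

theorem theorem4:
  fixes d :: nat
    and W :: "'x::finite \<Rightarrow> complex mat"
    and p :: "'x \<Rightarrow> real"
    and M :: "nat \<Rightarrow> nat"
    and C :: "nat \<Rightarrow> nat \<Rightarrow> nat \<Rightarrow> 'x"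
  assumes W: "\<forall>x. density_mat d (W x)"
    and p: "prob_dist p"
    and p_opt: "ereal (mutual_info d W p) =
       (INF q \<in> {q. prob_dist q \<and> avg_state d W q = avg_state d W p}. ereal (mutual_info d W q))"
    and M: "\<forall>n. 1 \<le> M n"
    and rate: "liminf (\<lambda>n. ereal (log 2 (real (M n)) / real n)) < ereal (mutual_info d W p)"
  shows "limsup (\<lambda>n. ereal (trace_norm (d ^ n)
            (codebook_state d W n (M n) (C n) - tensor_power (avg_state d W p) n) / 2)) = 1"
proof -
  define \<sigma> where "\<sigma> = avg_state d W p"
  define T where "T = (\<lambda>n. trace_norm (d ^ n) (codebook_state d W n (M n) (C n) - tensor_power \<sigma> n) / 2)"
  have W': "density_mat d (W x)" for x using W by blast
  have \<sigma>: "density_mat d \<sigma>" unfolding \<sigma>_def by (rule avg_state_density[OF W' p])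
  have upper: "T n \<le> 1" for n
    unfolding T_def by (rule codebook_trace_distance_le[OF W' \<sigma>]) (use M in blast)
  have opt: "mutual_info d W p \<le> mutual_info d W q" if "prob_dist q" "avg_state d W q = avg_state d W p" for q
  proof -
    have "ereal (mutual_info d W p) \<le> ereal (mutual_info d W q)"
      unfolding p_opt using that by (intro INF_lower) simp
    then show ?thesis by simp
  qed
  obtain R where R: "liminf (\<lambda>n. ereal (log 2 (real (M n)) / real n)) < ereal R" "R < mutual_info d W p"
    using ereal_dense2[OF rate] by auto
  \<comment> \<open>The exponent per letter will be
    \<open>R - mutual_info d W p + 4 * \<delta>\<close>. With the gap equal to
    \<open>8 * \<delta>\<close> it is \<open>- (4 * \<delta>)\<close>.\<close>
  define \<delta> where "\<delta> = (mutual_info d W p - R) / 8"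
  have \<delta>: "0 < \<delta>" unfolding \<delta>_def using R(2) by simp
  obtain A where A: "hermitian_mat d A" and lag: "\<And>x. entropy d (W x)
      \<le> (entropy d \<sigma> - mutual_info d W p + \<delta>) + (Re (mtrace (W x * A)) - Re (mtrace (\<sigma> * A)))"
    using entropy_lagrange_multiplier[OF W' p opt \<delta>] unfolding \<sigma>_def by blast
  have "\<exists>K. \<forall>n M cw. 0 < n \<longrightarrow> 1 \<le> M \<longrightarrow> 1 - K / real n
      - real M * 2 powr (real n * ((entropy d \<sigma> - mutual_info d W p + \<delta>) + 2 * \<delta>))
        * 2 powr (- (real n * (entropy d \<sigma> - \<delta>)))
      \<le> trace_norm (d ^ n) (codebook_state d W n M cw - tensor_power \<sigma> n) / 2"
    by (rule finite_blocklength_bound[OF W' \<sigma> A \<delta> lag])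
  then obtain K where K_all: "\<forall>n M cw. 0 < n \<longrightarrow> 1 \<le> M \<longrightarrow> 1 - K / real n
      - real M * 2 powr (real n * ((entropy d \<sigma> - mutual_info d W p + \<delta>) + 2 * \<delta>))
        * 2 powr (- (real n * (entropy d \<sigma> - \<delta>)))
      \<le> trace_norm (d ^ n) (codebook_state d W n M cw - tensor_power \<sigma> n) / 2" by (rule exE)
  have K: "1 - K / real n
      - real (M n) * 2 powr (real n * ((entropy d \<sigma> - mutual_info d W p + \<delta>) + 2 * \<delta>))
        * 2 powr (- (real n * (entropy d \<sigma> - \<delta>))) \<le> T n" if "0 < n" for n
    unfolding T_def using K_all[rule_format, of n "M n" "C n"] that M by simp
  define g where "g = (\<lambda>n::nat. 1 - K / real n - 2 powr (- (4 * \<delta>) * real n))"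
  have bound: "g n \<le> T n" if n: "0 < n" and r: "log 2 (real (M n)) / real n < R" for n
  proof -
    have "log 2 (real (M n)) \<le> real n * R" using n r by (simp add: field_simps)
    moreover have "0 < real (M n)" using M by (simp add: Suc_le_eq)
    ultimately have Mn: "real (M n) \<le> 2 powr (real n * R)" by (simp add: log_le_iff)
    let ?x = "real n * ((entropy d \<sigma> - mutual_info d W p + \<delta>) + 2 * \<delta>)" and ?y = "- (real n * (entropy d \<sigma> - \<delta>))"
    have "real (M n) * 2 powr ?x * 2 powr ?y \<le> 2 powr (real n * R) * 2 powr ?x * 2 powr ?y"
      using Mn by (intro mult_right_mono) auto
    also have "\<dots> = 2 powr (real n * R + ?x + ?y)" by (simp only: powr_add)
    also have "real n * R + ?x + ?y = - (4 * \<delta>) * real n"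
      unfolding \<delta>_def by (simp add: field_simps)
    finally show ?thesis using K[OF n] unfolding g_def by linarith
  qed
  have "(\<lambda>n. 1 - K / real n - 2 powr (- (4 * \<delta>) * real n)) \<longlonglongrightarrow> 1 - 0 - 0"
    using \<delta> by (intro tendsto_intros) real_asymp+
  then have g: "g \<longlonglongrightarrow> 1" unfolding g_def by simp
  \<comment> \<open>The assumption on the liminf gives a rate below \<open>R\<close> only for
    infinitely many \<open>n\<close>, which suffices for a limsup.\<close>
  have freq: "\<exists>\<^sub>F n in sequentially. log 2 (real (M n)) / real n < R"
  proof (rule ccontr)
    assume "\<not> ?thesis"
    then have "\<forall>\<^sub>F n in sequentially. ereal R \<le> ereal (log 2 (real (M n)) / real n)"
      by (simp add: not_frequently not_less)
    then have "ereal R \<le> liminf (\<lambda>n. ereal (log 2 (real (M n)) / real n))" by (rule Liminf_bounded)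
    then show False using R(1) by simp
  qed
  have "limsup (\<lambda>n. ereal (T n)) = 1"
  proof (rule antisym)
    show "limsup (\<lambda>n. ereal (T n)) \<le> 1" using upper by (intro Limsup_bounded always_eventually) auto
    show "1 \<le> limsup (\<lambda>n. ereal (T n))"
    proof (rule ccontr)
      assume "\<not> ?thesis"
      then have "limsup (\<lambda>n. ereal (T n)) < ereal 1" unfolding not_le one_ereal_def .
      then obtain r where r: "limsup (\<lambda>n. ereal (T n)) < ereal r" "r < 1"
        using ereal_dense2[of "limsup (\<lambda>n. ereal (T n))" "ereal 1"] by auto
      have "\<forall>\<^sub>F n in sequentially. ereal (T n) < ereal r" using r(1) by (rule Limsup_lessD)
      moreover have "\<forall>\<^sub>F n in sequentially. r < g n" using g r(2) by (rule order_tendstoD)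
      moreover have "\<forall>\<^sub>F n in sequentially. 0 < n" by (rule eventually_gt_at_top)
      \<comment> \<open>For large \<open>n\<close> the distance lies below \<open>r\<close> and
        \<open>g n\<close> above it, so by \<open>bound\<close> the rate cannot be below
        \<open>R\<close>.\<close>
      ultimately have "\<forall>\<^sub>F n in sequentially. \<not> log 2 (real (M n)) / real n < R"
      proof eventually_elim
        case (elim n)
        then show ?case using bound[of n] by auto
      qed
      then show False using freq by (simp add: not_frequently[symmetric])
    qed
  qed
  then show ?thesis unfolding T_def \<sigma>_def .
qed

end
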